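(* Let $s=\sigma+it$ with $\sigma,t$ real. Then $$\Bigl|\mathcal{R}(s)-\sum_{1\le n\le \sqrt{t/2\pi}}\frac{1}{n^s}\Bigr|\le \Bigl(\frac{t}{2\pi}\Bigr)^{-\sigma/2}\qquad\text{for } 0\le\sigma\le1,\ t\ge 3\pi,$$ and $$\Bigl|\mathcal{R}(s)-\sum_{1\le n\le \sqrt{t/2\pi}}\frac{1}{n^s}\Bigr|\le \Bigl(\frac{t}{2\pi}\Bigr)^{-1/2}\qquad\text{for } \sigma\ge1,\ t\ge 16\pi.$$
   Context: $\mathcal{R}(s)$ is Riemann's auxiliary function, the entire function defined for all $s\in\mathbf{C}$ by $$\mathcal{R}(s)=\int_{L}\frac{x^{-s}e^{\pi i x^2}}{e^{\pi i x}-e^{-\pi i x}}\,dx,$$ where $L$ is the straight line through a point $c$ of the real interval $(0,1)$ (the value does not depend on $c$) parallel to the bisector of the first quadrant, i.e. $\{c+ue^{\pi i/4}:u\in\mathbf{R}\}$, traversed from upper right to lower left ($u$ decreasing from $+\infty$ to $-\infty$), and $x^{-s}=\exp(-s\log x)$ with the principal branch of $\log$. *)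

theory Defs
  imports "HOL-Complex_Analysis.Complex_Analysis"
begin

definition riemann_aux_integrand :: "complex \<Rightarrow> complex \<Rightarrow> complex" where
  "riemann_aux_integrand s x =
     x powr (-s) * exp (of_real pi * \<i> * x^2) /
     (exp (of_real pi * \<i> * x) - exp (- (of_real pi * \<i> * x)))"

text \<open>
  The line through \<open>c\<close> parallel to the bisector of the first quadrant. For \<open>c > 0\<close> it meets
  neither \<open>0\<close> nor the negative real axis, so \<open>powr\<close>, which uses the principal branch of the
  logarithm, is holomorphic near it.
\<close>

definition riemann_aux_line :: "real \<Rightarrow> real \<Rightarrow> complex" where
  "riemann_aux_line c u = of_real c + of_real u * exp (of_real pi * \<i> / 4)"

text \<open>
  Riemann's auxiliary function, with the crossing point \<open>c\<close> as an explicit parameter ranging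
  over the interval from 0 to 1. The value does not depend on \<open>c\<close>. The integration limits run
  from \<open>\<infinity>\<close> down to \<open>-\<infinity>\<close>, so the line is traversed from upper right to lower left.
  The last factor is the derivative of the parametrization. For \<open>0 < c < 1\<close> the integral is
  absolutely convergent.
\<close>

definition riemann_aux :: "real \<Rightarrow> complex \<Rightarrow> complex" where
  "riemann_aux c s =
     (LBINT u=\<infinity>..-\<infinity>. riemann_aux_integrand s (riemann_aux_line c u) * exp (of_real pi * \<i> / 4))"

end

theory Submission
  imports Defs "HOL-Probability.Distributions" "HOL-Real_Asymp.Real_Asymp"
begin

text \<open>
  Write \<open>a = sqrt (t / (2 * pi))\<close> and \<open>N\<close> for its integer part. Moving the line of integration from
  \<open>c\<close> to \<open>q = N + 1/2\<close> picks up the residues \<open>1 / n powr s\<close> for \<open>n \<le> N\<close>, so the error is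
  the same integral over a line that crosses the real axis near the saddle point \<open>a\<close>, and it is
  enough to bound the absolute value of the integrand there. At \<open>x = q * (1 + y + \<i> * y)\<close> it is at most
  a Gaussian in \<open>y\<close>: since \<open>q\<close> is a half-integer, the denominator is at least
  \<open>2 * sqrt (1 + 2/3 * (pi * q * y)^4)\<close>, and this growth absorbs the cubic error of the
  quadratic approximation of the exponent for \<open>0 \<le> q * y \<le> 1/2\<close>. The two tails are
  small. For \<open>Re s \<ge> 1\<close> the line satisfies \<open>norm x \<ge> q / sqrt 2 \<ge> 1\<close>, so the
  exponent \<open>Re s\<close> may be replaced by \<open>1\<close>.
\<close>

section \<open>Elementary inequalities\<close>

text \<open>The bound 1 leaves almost no room: the three parts of the majorant add up to about
  0.996, which forces the sharp numerical constants. The line cannot run through the saddle point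
  \<open>a\<close> itself, which may lie at or near a pole. The half-integer \<open>q\<close> keeps
  the denominator large, but the displacement \<open>\<bar>a - q\<bar> \<le> 1/2\<close> shifts the
  centre of the Gaussian and multiplies its mass by up to about \<open>exp (pi/4)\<close>, nearly
  2.2. The cubic error for \<open>y > 0\<close> cannot be estimated on its own either: its bound
  \<open>517/100 * (q*y)^3\<close> reaches 0.65 at \<open>q*y = 1/2\<close>, almost a factor 2,
  whereas compared with the denominator it costs only a factor 1.04. For \<open>y < 0\<close> the
  cubic terms have the favourable sign. The cuts are \<open>y = 1/(2*q)\<close>, up to which that
  comparison is made, and \<open>y = -1/2\<close>, where the line is closest to 0. The recurring
  quadratic \<open>1 + 2*y + 2*y^2\<close> is the squared modulus of
  \<open>1 + y + \<i> * y\<close>.\<close>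

lemma one_plus_pos: "1 + 2*y + 2*(y::real)^2 > 0"
proof -
  have "1 + 2*y + 2*y^2 = (1+y)^2 + y^2" by algebra
  also have "\<dots> > 0" by (subst sum_power2_gt_zero_iff) linarith
  finally show ?thesis .
qed

text \<open>\<open>arctan (y / (1 + y))\<close> is the argument of \<open>1 + y + \<i> * y\<close>
  while the real part is positive, so the derivative is the imaginary part of
  \<open>(1 + \<i>) / (1 + y + \<i> * y)\<close>.\<close>

lemma arctan_quotient_has_derivative:
  fixes y :: real
  assumes "1 + y > 0"
  shows "((\<lambda>y. arctan (y / (1 + y))) has_real_derivative 1 / (1 + 2*y + 2*y^2)) (at y within A)"
proof -
  have p: "1 + 2*y + 2*y^2 > 0" by (rule one_plus_pos)
  have "(inverse (1 + (y/(1+y))\<^sup>2)) * (1 / (1+y)^2) = 1 / (1 + 2*y + 2*y^2)"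
    using assms p by (simp add: divide_simps power2_eq_square) (simp add: algebra_simps)
  moreover have "((\<lambda>y. arctan (y / (1 + y))) has_real_derivative
      (inverse (1 + (y/(1+y))\<^sup>2)) * (1 / (1+y)^2)) (at y within A)"
    using assms by (auto intro!: derivative_eq_intros simp: power2_eq_square divide_simps)
  ultimately show ?thesis by simp
qed

lemma sophie_germain_real: "(1 + 2*y + 2*y^2) * (1 - 2*y + 2*y^2) = 1 + 4 * (y::real)^4"
  by algebra

text \<open>The two quadratics multiply to \<open>1 + 4*y^4\<close>, hence to at least 1, and the
  two sides agree through order 3. The polynomial side can be integrated.\<close>

lemma inverse_quadratic_le: "1 / (1 + 2*y + 2*y^2) \<le> 1 - 2*y + 2*(y::real)^2"
  using one_plus_pos[of y] sophie_germain_real[of y] by (simp add: pos_divide_le_eq mult.commute)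

text \<open>The slope of the argument decreases for nonnegative \<open>y\<close>, so the graph stays
  below its tangent at \<open>z\<close>. With \<open>z = 1 / (2*q)\<close> this controls the right
  tail.\<close>

lemma arctan_quotient_increment_le:
  fixes y z :: real
  assumes "0 \<le> z" "z \<le> y"
  shows "arctan (y / (1 + y)) \<le> arctan (z / (1 + z)) + (1 - 2*z + 2*z^2) * (y - z)"
proof -
  let ?h = "\<lambda>x. arctan (x / (1 + x)) - (1 - 2*z + 2*z^2) * x"
  have "?h y \<le> ?h z"
  proof (rule DERIV_nonpos_imp_nonincreasing[OF assms(2)])
    fix x assume x: "z \<le> x" "x \<le> y"
    have "1 / (1 + 2*x + 2*x^2) \<le> 1 / (1 + 2*z + 2*z^2)"
      using x assms one_plus_pos[of z] one_plus_pos[of x]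
      by (intro divide_left_mono add_mono mult_left_mono power_mono mult_pos_pos) auto
    also have "\<dots> \<le> 1 - 2*z + 2*z^2" by (rule inverse_quadratic_le)
    finally have "1 / (1 + 2*x + 2*x^2) - (1 - 2*z + 2*z^2) \<le> 0" by simp
    moreover have "(?h has_real_derivative 1 / (1 + 2*x + 2*x^2) - (1 - 2*z + 2*z^2)) (at x)"
      using x assms by (intro DERIV_diff arctan_quotient_has_derivative) (auto intro!: derivative_eq_intros)
    ultimately show "\<exists>y. (?h has_real_derivative y) (at x) \<and> y \<le> 0" by blast
  qed
  then show ?thesis by (simp add: algebra_simps)
qed

lemma arctan_quotient_le_cubic:
  fixes y :: real
  assumes "0 \<le> y"
  shows "arctan (y / (1 + y)) \<le> y - y^2 + 2/3 * y^3"
proof -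
  let ?h = "\<lambda>x. arctan (x / (1 + x)) - (x - x^2 + 2/3 * x^3)"
  have "?h y \<le> ?h 0"
  proof (rule DERIV_nonpos_imp_nonincreasing[OF assms])
    fix x assume x: "0 \<le> x" "x \<le> y"
    have "(?h has_real_derivative 1 / (1 + 2*x + 2*x^2) - (1 - 2*x + 2*x^2)) (at x)"
      using x by (intro DERIV_diff arctan_quotient_has_derivative)
        (auto intro!: derivative_eq_intros simp: power2_eq_square)
    then show "\<exists>y. (?h has_real_derivative y) (at x) \<and> y \<le> 0" using inverse_quadratic_le[of x] by force
  qed
  then show ?thesis by simp
qed

lemma arctan_quotient_le_quadratic:
  fixes y :: real
  assumes "-(1/2) \<le> y" "y \<le> 0"
  shows "arctan (y / (1 + y)) \<le> y - y^2"
proof -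
  let ?h = "\<lambda>x. arctan (x / (1 + x)) - (x - x^2)"
  have "?h y \<le> ?h 0"
  proof (rule DERIV_nonneg_imp_nondecreasing[OF assms(2)])
    fix x assume x: "y \<le> x" "x \<le> 0"
    have "(1 - 2*x) * (1 + 2*x + 2*x^2) = 1 - 2*x^2*(1 + 2*x)" by algebra
    also have "\<dots> \<le> 1" using x assms by simp
    finally have "1 - 2*x \<le> 1 / (1 + 2*x + 2*x^2)" using one_plus_pos[of x] by (simp add: pos_le_divide_eq)
    moreover have "(?h has_real_derivative 1 / (1 + 2*x + 2*x^2) - (1 - 2*x)) (at x)"
      using x assms by (intro DERIV_diff arctan_quotient_has_derivative) (auto intro!: derivative_eq_intros)
    ultimately show "\<exists>y. (?h has_real_derivative y) (at x) \<and> 0 \<le> y" by force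
  qed
  then show ?thesis by simp
qed

text \<open>The exponent is the third-order Taylor polynomial of the logarithm of the squared
  modulus; it has no quadratic term because \<open>(1 + \<i>)^2\<close> is purely imaginary.\<close>

lemma exp_cubic_le_quadratic:
  fixes y :: real
  assumes "0 \<le> y"
  shows "exp (2*y - 4/3 * y^3) \<le> 1 + 2*y + 2*y^2"
proof -
  let ?h = "\<lambda>x. ln (1 + 2*x + 2*x^2) - (2*x - 4/3 * x^3)"
  have "?h 0 \<le> ?h y"
  proof (rule DERIV_nonneg_imp_nondecreasing[OF assms])
    fix x assume x: "0 \<le> x" "x \<le> y"
    note p = one_plus_pos[of x]
    have "(2 - 4*x^2) * (1 + 2*x + 2*x^2) = 2 + 4*x - 8*x^3 - 8*x^4" by algebra
    also have "\<dots> \<le> 2 + 4*x" using zero_le_power[OF x(1), of 3] zero_le_power[OF x(1), of 4] by linarith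
    finally have "2 - 4*x^2 \<le> (2 + 4*x) / (1 + 2*x + 2*x^2)" using p by (simp add: pos_le_divide_eq)
    moreover have "(?h has_real_derivative (2 + 4*x) / (1 + 2*x + 2*x^2) - (2 - 4*x^2)) (at x)"
      using p by (auto intro!: derivative_eq_intros simp: power2_eq_square)
    ultimately show "\<exists>y. (?h has_real_derivative y) (at x) \<and> 0 \<le> y" by force
  qed
  then have "2*y - 4/3 * y^3 \<le> ln (1 + 2*y + 2*y^2)" by simp
  then show ?thesis using one_plus_pos[of y] by (metis exp_le_cancel_iff exp_ln)
qed

lemma exp_le_quadratic:
  fixes y :: real
  assumes "y \<le> 0"
  shows "exp (2*y) \<le> 1 + 2*y + 2*y^2"
proof -
  let ?h = "\<lambda>x. exp (2*x) - (1 + 2*x + 2*x^2)"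
  have "?h y \<le> ?h 0"
  proof (rule DERIV_nonneg_imp_nondecreasing[OF assms])
    fix x assume x: "y \<le> x" "x \<le> 0"
    have "(?h has_real_derivative 2 * exp (2*x) - (2 + 4*x)) (at x)"
      by (auto intro!: derivative_eq_intros)
    moreover have "2 * exp (2*x) - (2 + 4*x) \<ge> 0" using exp_ge_add_one_self[of "2*x"] by linarith
    ultimately show "\<exists>y. (?h has_real_derivative y) (at x) \<and> 0 \<le> y" by blast
  qed
  then show ?thesis by simp
qed

lemma nonneg_if_deriv_nonneg:
  fixes f f' :: "real \<Rightarrow> real"
  assumes "\<And>x. (f has_real_derivative f' x) (at x)" "\<And>x. 0 \<le> x \<Longrightarrow> 0 \<le> f' x" "0 \<le> f 0" "0 \<le> x"
  shows "0 \<le> f x"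
  using DERIV_nonneg_imp_nondecreasing[OF assms(4), of f] assms by (meson order_trans)

text \<open>The difference of the two sides and its first five derivatives vanish at 0, and the
  sixth derivative is \<open>cosh x - cos x\<close>. The fact labelled \<open>k\<close> says that
  the \<open>k\<close>-th derivative is nonnegative, so integrating upwards from 6 gives the
  claim.\<close>

lemma cosh_plus_cos_ge:
  fixes x :: real
  assumes "0 \<le> x"
  shows "cosh x + cos x \<ge> 2 + x^4 / 12"
proof -
  have 6: "0 \<le> cosh x - cos x" for x :: real
    using cosh_real_ge_1[of x] cos_le_one[of x] by linarith
  have 5: "0 \<le> x \<Longrightarrow> 0 \<le> sinh x - sin x" for x :: real
    by (rule nonneg_if_deriv_nonneg[where f' = "\<lambda>x. cosh x - cos x"])
       (auto intro!: derivative_eq_intros simp: 6[simplified])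
  have 4: "0 \<le> x \<Longrightarrow> 0 \<le> cosh x + cos x - 2" for x :: real
    by (rule nonneg_if_deriv_nonneg[where f' = "\<lambda>x. sinh x - sin x"])
       (auto intro!: derivative_eq_intros simp: 5[simplified])
  have 3: "0 \<le> x \<Longrightarrow> 0 \<le> sinh x + sin x - 2 * x" for x :: real
    by (rule nonneg_if_deriv_nonneg[where f' = "\<lambda>x. cosh x + cos x - 2"])
       (auto intro!: derivative_eq_intros simp: 4[simplified])
  have 2: "0 \<le> x \<Longrightarrow> 0 \<le> cosh x - cos x - x^2" for x :: real
    by (rule nonneg_if_deriv_nonneg[where f' = "\<lambda>x. sinh x + sin x - 2 * x"])
       (auto intro!: derivative_eq_intros simp: 3[simplified])
  have 1: "0 \<le> x \<Longrightarrow> 0 \<le> sinh x - sin x - 1/3 * x^3" for x :: real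
  proof (rule nonneg_if_deriv_nonneg[where f = "\<lambda>x. sinh x - sin x - 1/3 * x^3" and f' = "\<lambda>x. cosh x - cos x - x^2"])
    show "((\<lambda>x. sinh x - sin x - 1/3 * x^3) has_real_derivative cosh x - cos x - x^2) (at x)" for x :: real
      by (auto intro!: derivative_eq_intros simp: power2_eq_square)
  qed (use 2 in auto)
  have "0 \<le> cosh x + cos x - 2 - 1/12 * x^4"
  proof (rule nonneg_if_deriv_nonneg[where f = "\<lambda>x. cosh x + cos x - 2 - 1/12 * x^4" and f' = "\<lambda>x. sinh x - sin x - 1/3 * x^3", OF _ _ _ assms])
    show "((\<lambda>x. cosh x + cos x - 2 - 1/12 * x^4) has_real_derivative sinh x - sin x - 1/3 * x^3) (at x)" for x :: real
      by (auto intro!: derivative_eq_intros)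
  qed (use 1 in auto)
  then show ?thesis by simp
qed

text \<open>The left side is the squared modulus of \<open>cos (x + \<i> * x)\<close>. After the
  double-angle formulas the quadratic terms cancel, so the growth starts with the fourth power; the
  coefficient is \<open>2^4 / 24\<close>.\<close>

lemma cos_sinh_square_ge:
  fixes x :: real
  assumes "0 \<le> x"
  shows "(cos x)^2 + (sinh x)^2 \<ge> 1 + 2/3 * x^4"
proof -
  have "(cos x)^2 + (sinh x)^2 = (cosh (2*x) + cos (2*x)) / 2"
    using cosh_double_cosh[of x] cos_double_cos[of x] cosh_square_eq[of x] by simp
  then show ?thesis using cosh_plus_cos_ge[of "2*x"] assms by (simp add: power_mult_distrib)
qed

lemma cos_sinh_square_ge_1: "(cos x)^2 + (sinh x)^2 \<ge> (1::real)"
proof -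
  have "1 \<le> 1 + 2/3 * \<bar>x\<bar>^4" by simp
  also have "\<dots> \<le> (cos \<bar>x\<bar>)^2 + (sinh \<bar>x\<bar>)^2" by (rule cos_sinh_square_ge) simp
  also have "\<dots> = (cos x)^2 + (sinh x)^2" by (cases "x \<ge> 0") auto
  finally show ?thesis .
qed

section \<open>Pointwise bounds near the saddle point\<close>

text \<open>The \<open>n\<close>-th power of \<open>1 - x/n \<le> exp (- (x/n))\<close>. With a
  numeral \<open>n\<close> it reduces upper bounds for \<open>exp\<close> at rationals to rational
  arithmetic.\<close>

lemma exp_le_inverse_power:
  fixes x :: real
  assumes "x < real n" "n > 0"
  shows "exp x \<le> 1 / (1 - x / n) ^ n"
proof -
  have p: "1 - x / n > 0" using assms by simp
  have "1 - x / n \<le> exp (- (x / n))" using exp_ge_add_one_self[of "- (x/n)"] by simp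
  then have "(1 - x / n) ^ n \<le> exp (- (x / n)) ^ n" using p by (intro power_mono) auto
  also have "\<dots> = exp (- x)" using assms by (simp flip: exp_of_nat_mult)
  finally show ?thesis using p by (simp add: exp_minus field_simps)
qed

lemma exp_mult_le_chord:
  fixes v l :: real
  assumes "0 \<le> l" "l \<le> 1"
  shows "exp (l * v) \<le> 1 + l * (exp v - 1)"
  using convex_onD[OF exp_convex, of l 0 v] assms by (simp add: algebra_simps)

lemma pi_power4_ge: "pi^4 \<ge> 973/10"
proof -
  have "(973/10 :: real) \<le> (31415/10000)^4" by (simp add: power_divide)
  also have "\<dots> \<le> pi^4" using pi_approx by (intro power_mono) auto
  finally show ?thesis .
qed

text \<open>After squaring, \<open>r^3\<close> is traded for \<open>r^4\<close> plus a constant. The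
  constant gives the factor \<open>(104/100)^2\<close>; the exponential of the \<open>r^4\<close>
  term is convex in \<open>16 * r^4\<close>, which lies between 0 and 1, and its chord fits below
  \<open>1 + 2/3 * (pi * r)^4\<close>.\<close>

lemma exp_cubic_le_cos_sinh:
  fixes r :: real
  assumes "0 \<le> r" "r \<le> 1/2"
  shows "exp (517/100 * r^3) \<le> 104/100 * sqrt ((cos (pi * r))^2 + (sinh (pi * r))^2)"
proof -
  have pi4: "pi^4 \<ge> 973/10" by (rule pi_power4_ge)
  \<comment> \<open>Weighted arithmetic-geometric mean inequality with equality at
    \<open>r = 61/200\<close>. This point is chosen so that the resulting coefficient of
    \<open>r^4\<close> is just below \<open>16 * 159/100\<close>, where \<open>159/100\<close> still
    satisfies \<open>16 * (exp v - 1) \<le> 2/3 * pi^4\<close> for \<open>v\<close>.\<close>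
  have "0 \<le> (r - 61/200)^2 * (3 * r^2 + 2 * (61/200) * r + (61/200)^2)"
    using assms by simp
  also have "\<dots> = 3 * r^4 - 4 * (61/200) * r^3 + (61/200)^4" by algebra
  finally have "0 \<le> 3 * r^4 - 4 * (61/200) * r^3 + 13845841/1600000000"
    by (simp add: power_divide)
  then have amgm: "2 * (517/100) * r^3 \<le> 7335/100000 + (16 * r^4) * (159/100)"
    using zero_le_power[OF assms(1), of 4] by linarith
  have r4: "16 * r^4 \<le> 1" using power_mono[OF assms(2,1), of 4] by (simp add: power_divide)
  have "(exp (517/100 * r^3))^2 = exp (2 * (517/100) * r^3)" by (simp flip: exp_double)
  also have "\<dots> \<le> exp (7335/100000) * exp ((16 * r^4) * (159/100))"
    using amgm by (simp flip: exp_add)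
  also have "\<dots> \<le> 10816/10000 * (1 + (16 * r^4) * (exp (159/100) - 1))"
  proof (intro mult_mono exp_mult_le_chord)
    show "exp (7335/100000) \<le> (10816/10000 :: real)"
      using exp_le_inverse_power[of "7335/100000" 8] by (simp add: power_divide divide_simps)
  qed (use r4 assms in auto)
  also have "\<dots> \<le> 10816/10000 * (1 + 2/3 * (pi * r)^4)"
  proof -
    have "exp (159/100) \<le> (505/100 :: real)"
    proof -
      have "exp (159/100) \<le> exp (8/5 :: real)" by simp
      also have "\<dots> \<le> 505/100" using exp_le_inverse_power[of "8/5" 128] by (simp add: power_divide divide_simps)
      finally show ?thesis .
    qed
    then have "16 * (exp (159/100) - 1) \<le> 2/3 * pi^4" using pi4 by simp
    then have "r^4 * (16 * (exp (159/100) - 1)) \<le> r^4 * (2/3 * pi^4)"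
      using assms by (intro mult_left_mono) auto
    then show ?thesis by (simp add: power_mult_distrib algebra_simps)
  qed
  also have "\<dots> \<le> 10816/10000 * ((cos (pi * r))^2 + (sinh (pi * r))^2)"
    using cos_sinh_square_ge[of "pi * r"] assms by simp
  also have "\<dots> = (104/100 * sqrt ((cos (pi * r))^2 + (sinh (pi * r))^2))^2"
    by (simp add: power_mult_distrib) (simp add: power2_eq_square)
  finally show ?thesis by (rule power2_le_imp_le) simp
qed

text \<open>The denominator is \<open>2 * \<i> * sin (pi * x)\<close>. The balance of
  \<open>exp (Im s * Arg x)\<close> against \<open>exp (- (2 * pi * Re x * Im x))\<close> near the
  real axis is what puts the saddle point at \<open>a\<close>.\<close>

lemma norm_riemann_aux_integrand:
  assumes "x \<noteq> 0"
  shows "cmod (riemann_aux_integrand s x) =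
    cmod x powr (- Re s) * exp (Im s * Arg x) * exp (- (2 * pi * Re x * Im x)) /
    (2 * sqrt ((sin (pi * Re x))^2 + (sinh (pi * Im x))^2))"
proof -
  have "cmod (exp (of_real pi * \<i> * x) - exp (- (of_real pi * \<i> * x))) = 2 * cmod (sin (of_real pi * x))"
  proof -
    have "exp (of_real pi * \<i> * x) - exp (- (of_real pi * \<i> * x)) = 2 * \<i> * sin (of_real pi * x)"
      by (simp add: sin_exp_eq' mult_ac)
    then show ?thesis by (simp add: norm_mult)
  qed
  also have "cmod (sin (of_real pi * x)) = sqrt ((sin (pi * Re x))^2 + (sinh (pi * Im x))^2)"
  proof -
    have s: "(cmod (sin (of_real pi * x)))^2 = (sin (pi * Re x))^2 + (sinh (pi * Im x))^2"
      unfolding cmod_power2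
    proof -
      have "Re (sin (of_real pi * x)) = sin (pi * Re x) * cosh (pi * Im x)"
        "Im (sin (of_real pi * x)) = cos (pi * Re x) * sinh (pi * Im x)"
        by (simp_all add: Re_sin Im_sin cosh_def sinh_def)
      then show "(Re (sin (of_real pi * x)))^2 + (Im (sin (of_real pi * x)))^2
          = (sin (pi * Re x))^2 + (sinh (pi * Im x))^2"
        by (simp add: power_mult_distrib cosh_square_eq cos_squared_eq algebra_simps)
    qed
    then show ?thesis by (metis norm_ge_zero real_sqrt_unique)
  qed
  finally have d: "cmod (exp (of_real pi * \<i> * x) - exp (- (of_real pi * \<i> * x))) =
    2 * sqrt ((sin (pi * Re x))^2 + (sinh (pi * Im x))^2)" .
  have "cmod (x powr (-s)) = cmod x powr (- Re s) * exp (Im s * Arg x)"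
    using norm_powr_complex[of x "-s"] assms by simp
  moreover have "cmod (exp (of_real pi * \<i> * x^2)) = exp (- (2 * pi * Re x * Im x))"
    by (simp add: power2_eq_square)
  ultimately show ?thesis
    unfolding riemann_aux_integrand_def norm_divide norm_mult d by simp
qed

text \<open>\<open>q\<close> is the half-integer next to \<open>a\<close>. For
  \<open>q = 3/2\<close> the distance condition alone gives only \<open>2/3 * q \<le> a\<close>; the
  better constant \<open>4/5\<close> comes from \<open>t \<ge> 3 * pi\<close>.
  \<open>\<sigma>\<close> is the exponent of the weight and may be smaller than the real part of
  \<open>s\<close>.\<close>

locale saddle =
  fixes q a \<sigma> :: real
  assumes q: "3/2 \<le> q" and aq: "4/5 * q \<le> a" "\<bar>a - q\<bar> \<le> 1/2" and sigma: "0 \<le> \<sigma>" "\<sigma> \<le> 1"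
begin

text \<open>
  \<open>a powr \<sigma>\<close> times the absolute value of the integrand at \<open>q * (1 + y + \<i> * y)\<close>, for
  \<open>s = \<sigma> + 2 * pi * a^2 * \<i>\<close>.
\<close>

definition scaled_integrand :: "real \<Rightarrow> real" where
  "scaled_integrand y = (a / (q * sqrt (1 + 2*y + 2*y^2))) powr \<sigma> *
     exp (2 * pi * (a^2 * Arg (Complex (1 + y) y) - q^2 * (y + y^2))) /
     (2 * sqrt ((cos (pi * (q * y)))^2 + (sinh (pi * (q * y)))^2))"

lemma pos: "q > 0" "a > 0" and a_le: "a \<le> 4/3 * q" "a \<le> q + 1/2"
  using q aq by linarith+

lemma Arg_eq: "1 + y > 0 \<Longrightarrow> Arg (Complex (1 + y) y) = arctan (y / (1 + y))"
  by (simp add: arg_conv_arctan)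

text \<open>\<open>w\<close> is a lower bound for the logarithm of the modulus of
  \<open>1 + y + \<i> * y\<close>; the conclusion moves it into the exponent, where it joins the
  other terms.\<close>

lemma weight_le:
  assumes "exp w \<le> sqrt (1 + 2*y + 2*y^2)"
  shows "(a / (q * sqrt (1 + 2*y + 2*y^2))) powr \<sigma> \<le> (a / q) powr \<sigma> * exp (- \<sigma> * w)"
proof -
  have "a / (q * sqrt (1 + 2*y + 2*y^2)) \<le> a / (q * exp w)"
    using assms pos one_plus_pos[of y] by (intro divide_left_mono mult_left_mono mult_pos_pos) auto
  also have "\<dots> = (a / q) * exp (- w)" by (simp add: exp_minus field_simps)
  finally have "(a / (q * sqrt (1 + 2*y + 2*y^2))) powr \<sigma> \<le> ((a / q) * exp (- w)) powr \<sigma>"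
    using pos sigma one_plus_pos[of y] by (intro powr_mono2) auto
  also have "\<dots> = (a / q) powr \<sigma> * exp (- \<sigma> * w)"
    using pos powr_mult[of "a / q" "exp (- w)" \<sigma>] by (simp add: exp_powr_real mult.commute)
  finally show ?thesis .
qed

text \<open>Up to the constant factor, the Gaussian exponent is the second-order Taylor polynomial
  at 0 of the logarithm of the numerator. For negative \<open>y\<close> it is already an upper
  bound; for \<open>y \<ge> 0\<close> the cubic remainder is paid for by the denominator. The
  constant is \<open>104/100\<close> divided by the 2 of the denominator.\<close>

lemma scaled_integrand_le_central:
  assumes "-(1/2) \<le> y" "y \<le> 1 / (2*q)"
  shows "scaled_integrand y \<le> 52/100 * (a/q) powr \<sigma> *
     exp ((2*pi*(a^2 - q^2) - \<sigma>) * y - 2*pi*(a^2 + q^2) * y^2)"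
    (is "_ \<le> 52/100 * ?A * exp ?E")
proof -
  define D where "D = sqrt ((cos (pi * (q * y)))^2 + (sinh (pi * (q * y)))^2)"
  have D1: "1 \<le> D" unfolding D_def using cos_sinh_square_ge_1 by simp
  define X where "X = 2 * pi * (a^2 * Arg (Complex (1 + y) y) - q^2 * (y + y^2))"
  define V where "V = (a / (q * sqrt (1 + 2*y + 2*y^2))) powr \<sigma>"
  have y1: "1 + y > 0" using assms by linarith
  have key: "V * exp X \<le> 104/100 * ?A * exp ?E * D"
  proof (cases "y \<ge> 0")
    case True
    define w where "w = y - 2/3 * y^3"
    have "exp (w) = sqrt (exp (2*y - 4/3 * y^3))"
      by (rule real_sqrt_unique[symmetric]) (simp_all add: w_def flip: exp_double)
    also have "\<dots> \<le> sqrt (1 + 2*y + 2*y^2)" using exp_cubic_le_quadratic[OF True] by simp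
    finally have V: "V \<le> ?A * exp (- \<sigma> * w)" unfolding V_def by (rule weight_le)
    have "Arg (Complex (1 + y) y) \<le> y - y^2 + 2/3 * y^3"
      using arctan_quotient_le_cubic[OF True] Arg_eq[OF y1] by simp
    then have "X \<le> 2 * pi * (a^2 * (y - y^2 + 2/3 * y^3) - q^2 * (y + y^2))"
      unfolding X_def by (intro mult_left_mono diff_right_mono) auto
    then have "- \<sigma> * w + X \<le> ?E + (4/3 * pi * a^2 + 2/3 * \<sigma>) * y^3"
      unfolding w_def by (simp add: algebra_simps)
    \<comment> \<open>Here \<open>a^2 \<le> 16/9 * q^2 \<le> 32/27 * q^3\<close> because
      \<open>q \<ge> 3/2\<close>, and \<open>2/3 * \<sigma>\<close> is at most
      \<open>16/81 * q^3\<close>. The two coefficients add up to about 5.162.\<close>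
    also have "(4/3 * pi * a^2 + 2/3 * \<sigma>) * y^3 \<le> 517/100 * q^3 * y^3"
    proof (intro mult_right_mono)
      have "a^2 \<le> (4/3 * q)^2" using a_le pos by (intro power_mono) auto
      also have "\<dots> \<le> 32/27 * q^3" using q by (simp add: power2_eq_square power3_eq_cube)
      finally have "4/3 * pi * a^2 \<le> 4/3 * (31416/10000) * (32/27 * q^3)"
        using pi_approx by (intro mult_mono) auto
      moreover have "27/8 \<le> q^3" using power_mono[OF q, of 3] by (simp add: power_divide)
      ultimately show "4/3 * pi * a^2 + 2/3 * \<sigma> \<le> 517/100 * q^3" using sigma by linarith
    qed (use True in auto)
    finally have e: "- \<sigma> * w + X \<le> ?E + 517/100 * (q * y)^3" by (simp add: power_mult_distrib)
    have "V * exp X \<le> ?A * exp (- \<sigma> * w) * exp X" using V by (intro mult_right_mono) auto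
    also have "\<dots> = ?A * exp (- \<sigma> * w + X)" by (simp only: exp_add mult.assoc)
    also have "\<dots> \<le> ?A * exp (?E + 517/100 * (q * y)^3)" using e by (intro mult_left_mono) auto
    also have "\<dots> = ?A * exp ?E * exp (517/100 * (q * y)^3)" by (simp only: exp_add mult.assoc)
    also have "\<dots> \<le> ?A * exp ?E * (104/100 * D)"
      unfolding D_def
    proof (intro mult_left_mono exp_cubic_le_cos_sinh)
      show "q * y \<le> 1/2" using assms pos by (simp add: field_simps)
    qed (use True pos in auto)
    finally show ?thesis by (simp add: mult_ac)
  next
    case False
    have "exp y = sqrt (exp (2*y))"
      by (rule real_sqrt_unique[symmetric]) (simp_all flip: exp_double)
    also have "\<dots> \<le> sqrt (1 + 2*y + 2*y^2)" using exp_le_quadratic[of y] False by simp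
    finally have V: "V \<le> ?A * exp (- \<sigma> * y)" unfolding V_def by (rule weight_le)
    have "Arg (Complex (1 + y) y) \<le> y - y^2"
      using arctan_quotient_le_quadratic[of y] Arg_eq[OF y1] False assms by simp
    then have "X \<le> 2 * pi * (a^2 * (y - y^2) - q^2 * (y + y^2))"
      unfolding X_def by (intro mult_left_mono diff_right_mono) auto
    then have e: "- \<sigma> * y + X \<le> ?E" by (simp add: algebra_simps)
    have "V * exp X \<le> ?A * exp (- \<sigma> * y) * exp X" using V by (intro mult_right_mono) auto
    also have "\<dots> = ?A * exp (- \<sigma> * y + X)" by (simp only: exp_add mult.assoc)
    also have "\<dots> \<le> ?A * exp ?E" using e by (intro mult_left_mono) auto
    also have "\<dots> = ?A * exp ?E * 1" by simp
    also have "\<dots> \<le> ?A * exp ?E * (104/100 * D)" using D1 by (intro mult_left_mono) auto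
    finally show ?thesis by (simp add: mult_ac)
  qed
  have "scaled_integrand y = V * exp X / (2 * D)" by (simp add: scaled_integrand_def V_def X_def D_def)
  also have "\<dots> \<le> (104/100 * ?A * exp ?E * D) / (2 * D)" using key D1 by (intro divide_right_mono) auto
  also have "\<dots> = 52/100 * ?A * exp ?E" using D1 by simp
  finally show ?thesis .
qed

text \<open>At the cut \<open>z = 1 / (2*q)\<close> the exponent is at most 0 even for the largest
  admissible \<open>a = q + 1/2 = q * (1 + z)\<close>, and beyond it the exponent falls at least
  linearly. The weight is at most \<open>4/3\<close> and the square root in the denominator at least
  \<open>22/10\<close>, whence \<open>10/33\<close>.\<close>

lemma scaled_integrand_le_right:
  assumes "1 / (2*q) \<le> y"
  shows "scaled_integrand y \<le> 10/33 * exp (- 2*pi*(q*y - 1/2))"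
proof -
  define D where "D = sqrt ((cos (pi * (q * y)))^2 + (sinh (pi * (q * y)))^2)"
  define z where "z = 1 / (2*q)"
  have z: "0 < z" "z \<le> y" "z \<le> 1/3" "q = 1 / (2*z)" using assms q pos by (auto simp: z_def field_simps)
  have D: "22/10 \<le> D"
  proof -
    have "22/10 \<le> sqrt (1 + 2/3 * (pi/2)^4)"
    proof (rule real_le_rsqrt)
      show "(22/10)^2 \<le> 1 + 2/3 * (pi/2)^4" using pi_power4_ge by (simp add: power_divide)
    qed
    also have "\<dots> \<le> sqrt (1 + 2/3 * (pi * (q * y))^4)"
      using assms pos by (intro real_sqrt_le_mono add_mono mult_left_mono power_mono) (auto simp: field_simps)
    also have "\<dots> \<le> D" unfolding D_def using cos_sinh_square_ge[of "pi * (q*y)"] z pos by simp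
    finally show ?thesis .
  qed
  have V: "(a / (q * sqrt (1 + 2*y + 2*y^2))) powr \<sigma> \<le> 4/3"
  proof -
    have "a / (q * sqrt (1 + 2*y + 2*y^2)) \<le> (4/3*q) / (q * 1)"
      using a_le pos z by (intro frac_le mult_left_mono) auto
    also have "\<dots> = 4/3" using pos by simp
    finally have "(a / (q * sqrt (1 + 2*y + 2*y^2))) powr \<sigma> \<le> (4/3) powr \<sigma>"
      using pos sigma z by (intro powr_mono2) auto
    also have "\<dots> \<le> (4/3) powr 1" using sigma by (intro powr_mono) auto
    finally show ?thesis by simp
  qed
  have "a^2 * Arg (Complex (1 + y) y) - q^2 * (y + y^2) \<le> - (q*y - 1/2)"
  proof -
    have "Arg (Complex (1 + y) y) \<le> arctan (z / (1 + z)) + (1 - 2*z + 2*z^2) * (y - z)"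
      using arctan_quotient_increment_le[of z y] Arg_eq[of y] z by simp
    also have "\<dots> \<le> (z - z^2 + 2/3*z^3) + (1 - 2*z + 2*z^2) * (y - z)"
      using arctan_quotient_le_cubic[of z] z by simp
    finally have "a^2 * Arg (Complex (1 + y) y) \<le> a^2 * ((z - z^2 + 2/3*z^3) + (1 - 2*z + 2*z^2) * (y - z))"
      by (intro mult_left_mono) auto
    also have "\<dots> \<le> (q + 1/2)^2 * ((z - z^2 + 2/3*z^3) + (1 - 2*z + 2*z^2) * (y - z))"
    proof (intro mult_right_mono power_mono)
      have "z^2 \<le> z" "2*z \<le> 1" using z by (auto simp: power2_eq_square)
      then have "0 \<le> z - z^2 + 2/3*z^3" "0 \<le> 1 - 2*z + 2*z^2" using z by auto
      then show "0 \<le> (z - z^2 + 2/3*z^3) + (1 - 2*z + 2*z^2) * (y - z)" using z by simp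
    qed (use a_le pos in auto)
    finally have 1: "a^2 * Arg (Complex (1 + y) y)
      \<le> (q + 1/2)^2 * ((z - z^2 + 2/3*z^3) + (1 - 2*z + 2*z^2) * (y - z))" .
    have 2: "(q + 1/2)^2 * (z - z^2 + 2/3*z^3) \<le> q^2 * (z + z^2)"
    proof -
      have "(1 + z)^2 * (z - z^2 + 2/3*z^3) - (z + z^2) = z^3 * (-(1/3) + 1/3 * z + 2/3*z^2)"
        by algebra
      also have "\<dots> \<le> 0"
      proof (rule mult_nonneg_nonpos)
        have "z^2 \<le> 1/9" using z power_mono[of z "1/3" 2] by (simp add: power_divide)
        then show "-(1/3) + 1/3 * z + 2/3*z^2 \<le> 0" using z by linarith
      qed (use z in auto)
      finally have "q^2 * ((1 + z)^2 * (z - z^2 + 2/3*z^3)) \<le> q^2 * (z + z^2)"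
        by (intro mult_left_mono) auto
      moreover have "q + 1/2 = q * (1 + z)" using z by (simp add: field_simps)
      ultimately show ?thesis by (simp add: power_mult_distrib mult_ac)
    qed
    \<comment> \<open>Comparison of slopes at \<open>z\<close>: \<open>q^2 * (1 + 2*z)\<close> is
      the derivative of \<open>q^2 * (y + y^2)\<close>, and the surplus \<open>q\<close> is the
      decay rate obtained.\<close>
    have 3: "(q + 1/2)^2 * (1 - 2*z + 2*z^2) \<le> q^2 * (1 + 2*z) - q"
    proof -
      have "(1 + z)^2 * (1 - 2*z + 2*z^2) - 1 = z^2 * (-1 + 2*z + 2*z^2)"
        by algebra
      also have "\<dots> \<le> 0"
      proof (rule mult_nonneg_nonpos)
        have "z^2 \<le> 1/9" using z power_mono[of z "1/3" 2] by (simp add: power_divide)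
        then show "-1 + 2 * z + 2*z^2 \<le> 0" using z by linarith
      qed (use z in auto)
      finally have "q^2 * ((1 + z)^2 * (1 - 2*z + 2*z^2)) \<le> q^2 * 1"
        by (intro mult_left_mono) auto
      moreover have "q + 1/2 = q * (1 + z)" using z by (simp add: field_simps)
      moreover have "q^2 * (1 + 2*z) - q = q^2" using z by (simp add: field_simps power2_eq_square)
      ultimately show ?thesis by (simp add: power_mult_distrib mult_ac)
    qed
    have "(q + 1/2)^2 * ((z - z^2 + 2/3*z^3) + (1 - 2*z + 2*z^2) * (y - z))
       = (q + 1/2)^2 * (z - z^2 + 2/3*z^3) + ((q + 1/2)^2 * (1 - 2*z + 2*z^2)) * (y - z)"
      by (simp add: algebra_simps)
    also have "\<dots> \<le> q^2 * (z + z^2) + (q^2 * (1 + 2*z) - q) * (y - z)"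
      using 2 3 z by (intro add_mono mult_right_mono) auto
    also have "\<dots> = q^2 * (y + y^2) - q^2 * (y - z)^2 - q * (y - z)" by algebra
    also have "\<dots> \<le> q^2 * (y + y^2) - q * (y - z)" by simp
    also have "q * (y - z) = q * y - 1/2" using z by (simp add: field_simps)
    finally show ?thesis using 1 by linarith
  qed
  then have "2 * pi * (a^2 * Arg (Complex (1 + y) y) - q^2 * (y + y^2)) \<le> 2 * pi * (- (q*y - 1/2))"
    by (intro mult_left_mono) auto
  then have E: "exp (2 * pi * (a^2 * Arg (Complex (1 + y) y) - q^2 * (y + y^2))) \<le> exp (- 2*pi*(q*y - 1/2))"
    by (simp only: exp_le_cancel_iff mult_minus_left mult_minus_right)
  have "scaled_integrand y \<le> 4/3 * exp (- 2*pi*(q*y - 1/2)) / (2 * (22/10))"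
    unfolding scaled_integrand_def D_def[symmetric] using V E D by (intro frac_le mult_mono) auto
  then show ?thesis by simp
qed

text \<open>At \<open>y = -1/2\<close> the line is closest to 0 and the argument is
  \<open>- pi/4\<close>; further left the argument only decreases. Completing the square in
  \<open>y + y^2\<close> around this point leaves a half-Gaussian times a small constant.\<close>

lemma scaled_integrand_le_left:
  assumes "y \<le> -(1/2)"
  shows "scaled_integrand y \<le> 2/3 * sqrt 2 * exp (- (pi/2) * (pi * a^2 - q^2)) * exp (- (2*pi*q^2) * (y + 1/2)^2)"
proof -
  define D where "D = sqrt ((cos (pi * (q * y)))^2 + (sinh (pi * (q * y)))^2)"
  have D1: "1 \<le> D" unfolding D_def using cos_sinh_square_ge_1 by simp
  have V: "(a / (q * sqrt (1 + 2*y + 2*y^2))) powr \<sigma> \<le> 4/3 * sqrt 2"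
  proof -
    have "1/2 \<le> 1 + 2*y + 2*y^2"
    proof -
      have "1 + 2*y + 2*y^2 = 1/2 + 2 * (y + 1/2)^2" by algebra
      then show ?thesis by simp
    qed
    then have "sqrt (1/2) \<le> sqrt (1 + 2*y + 2*y^2)" by (rule real_sqrt_le_mono)
    then have "a / (q * sqrt (1 + 2*y + 2*y^2)) \<le> (4/3*q) / (q * sqrt (1/2))"
      using a_le pos by (intro frac_le mult_left_mono) auto
    also have "\<dots> = 4/3 * sqrt 2" using pos by (simp add: real_sqrt_divide)
    finally have "(a / (q * sqrt (1 + 2*y + 2*y^2))) powr \<sigma> \<le> (4/3 * sqrt 2) powr \<sigma>"
      using pos sigma one_plus_pos[of y] by (intro powr_mono2) auto
    also have "\<dots> \<le> (4/3 * sqrt 2) powr 1"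
    proof (intro powr_mono sigma)
      have "1 \<le> sqrt 2" by simp
      then show "1 \<le> 4/3 * sqrt 2" by linarith
    qed
    finally show ?thesis by simp
  qed
  have "Arg (Complex (1 + y) y) \<le> - (pi/4)"
  proof (cases "1 + y > 0")
    case True
    have "arctan (y / (1 + y)) \<le> arctan (-1)"
      using assms True by (intro arctan_monotone') (simp add: field_simps)
    then show ?thesis using Arg_eq[OF True] by (simp add: arctan_minus)
  next
    \<comment> \<open>The point is now in the lower half-plane but no longer in the open right one,
      so its principal argument is at most \<open>- pi/2\<close>.\<close>
    case False
    let ?z = "Complex (1 + y) y"
    have nz: "?z \<noteq> 0" using assms by (auto simp: complex_eq_iff)
    have "\<not> \<bar>Im (Ln ?z)\<bar> < pi/2" using False Re_Ln_pos_lt[OF nz] by simp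
    moreover have "Im (Ln ?z) < 0" using Im_Ln_pos_le[OF nz] assms mpi_less_Im_Ln[OF nz] Im_Ln_le_pi[OF nz]
      by auto
    ultimately have "Im (Ln ?z) \<le> - (pi/2)" by linarith
    then show ?thesis using Arg_eq_Im_Ln[OF nz] pi_gt_zero by linarith
  qed
  then have "a^2 * Arg (Complex (1 + y) y) \<le> a^2 * (- (pi/4))" by (intro mult_left_mono) auto
  then have "2 * pi * (a^2 * Arg (Complex (1 + y) y) - q^2 * (y + y^2))
      \<le> 2 * pi * (a^2 * (- (pi/4)) - q^2 * (y + y^2))" by (intro mult_left_mono) auto
  also have "\<dots> = - (pi/2) * (pi * a^2 - q^2) + (- (2*pi*q^2) * (y + 1/2)^2)"
    by (simp add: power2_eq_square algebra_simps)
  finally have E: "exp (2 * pi * (a^2 * Arg (Complex (1 + y) y) - q^2 * (y + y^2)))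
     \<le> exp (- (pi/2) * (pi * a^2 - q^2)) * exp (- (2*pi*q^2) * (y + 1/2)^2)"
    by (simp flip: exp_add)
  have "scaled_integrand y \<le> (4/3 * sqrt 2) * (exp (- (pi/2) * (pi * a^2 - q^2)) * exp (- (2*pi*q^2) * (y + 1/2)^2)) / (2 * 1)"
    unfolding scaled_integrand_def D_def[symmetric] using V E D1 by (intro frac_le mult_mono) auto
  then show ?thesis by simp
qed

end

section \<open>Gaussian and exponential integrals\<close>

lemma has_bochner_integral_gaussian:
  fixes B C :: real
  assumes "C > 0"
  shows "has_bochner_integral lborel (\<lambda>y. exp (B * y - C * y^2)) (sqrt (pi / C) * exp (B^2 / (4*C)))"
proof -
  define s where "s = sqrt (1 / (2*C))"
  have s: "s > 0" "s^2 = 1 / (2*C)" using assms by (auto simp: s_def)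
  have "has_bochner_integral lborel (normal_density (B / (2*C)) s) 1"
    using integrable_normal_density[OF s(1)] integral_normal_density[OF s(1)]
    by (simp add: has_bochner_integral_iff)
  then have "has_bochner_integral lborel (\<lambda>y. (sqrt (pi / C) * exp (B^2 / (4*C))) * normal_density (B / (2*C)) s y)
     ((sqrt (pi / C) * exp (B^2 / (4*C))) * 1)"
    by (rule has_bochner_integral_mult_right)
  moreover have "(sqrt (pi / C) * exp (B^2 / (4*C))) * normal_density (B / (2*C)) s y = exp (B * y - C * y^2)" for y
  proof -
    have "B^2 / (4*C) + - ((y - B / (2*C))^2 / (2 * s^2)) = B * y - C * y^2"
      using assms unfolding s(2) by (simp add: field_simps power2_eq_square)
    moreover have "2 * pi * s^2 = pi / C" using s by simp
    ultimately show ?thesis using assms unfolding normal_density_def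
      by (simp flip: exp_add)
  qed
  ultimately show ?thesis by simp
qed

lemma has_bochner_integral_gaussian_left:
  fixes K y0 :: real
  assumes "K > 0"
  shows "has_bochner_integral lborel (\<lambda>y. indicator {..y0} y * exp (- K * (y - y0)^2)) (sqrt (pi / K) / 2)"
proof -
  let ?g = "\<lambda>x::real. indicator {0..} x *\<^sub>R exp (- x\<^sup>2) :: real"
  let ?h = "\<lambda>x. ?g (sqrt K * y0 + (- sqrt K) * x)"
  have "has_bochner_integral lborel ?h ((sqrt pi / 2) /\<^sub>R \<bar>- sqrt K\<bar>)"
    by (rule lborel_has_bochner_integral_real_affine_iff[THEN iffD1, OF _ gaussian_moment_0]) (use assms in simp)
  moreover have "?h x = indicator {..y0} x * exp (- K * (x - y0)^2)" for x
  proof -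
    have "sqrt K * y0 + (- sqrt K) * x = sqrt K * (y0 - x)" by (simp add: algebra_simps)
    moreover have "(sqrt K * (y0 - x))^2 = K * (x - y0)^2"
      using assms by (simp add: power_mult_distrib power2_commute)
    ultimately show ?thesis using assms by (auto simp: indicator_def zero_le_mult_iff)
  qed
  moreover have "(sqrt pi / 2) /\<^sub>R \<bar>- sqrt K\<bar> = sqrt (pi / K) / 2"
    using assms by (simp add: real_sqrt_divide field_simps)
  ultimately show ?thesis by simp
qed

lemma has_bochner_integral_exp_right:
  fixes k y0 :: real
  assumes "k > 0"
  shows "has_bochner_integral lborel (\<lambda>y. indicator {y0..} y * exp (- k * (y - y0))) (1 / k)"
proof (rule has_bochner_integral_nn_integral)
  let ?F = "\<lambda>y. - (1/k) * exp (- k * (y - y0))"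
  have "(\<integral>\<^sup>+y. ennreal (exp (- k * (y - y0))) * indicator {y0..} y \<partial>lborel) = ennreal (0 - ?F y0)"
  proof (rule nn_integral_FTC_atLeast[where F = ?F])
    show "(?F has_real_derivative exp (- k * (x - y0))) (at x)" for x
      using assms by (auto intro!: derivative_eq_intros)
    show "(?F \<longlongrightarrow> 0) at_top" using assms by real_asymp
  qed auto
  moreover have "ennreal (indicator {y0..} y * exp (- k * (y - y0))) = ennreal (exp (- k * (y - y0))) * indicator {y0..} y" for y
    by (auto simp: indicator_def)
  ultimately show "(\<integral>\<^sup>+y. ennreal (indicator {y0..} y * exp (- k * (y - y0))) \<partial>lborel) = ennreal (1 / k)"
    by simp
qed (use assms in auto)

section \<open>The integral of the majorant\<close>

lemma exp_ge_power:
  fixes x :: real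
  assumes "0 \<le> x" "n > 0"
  shows "(1 + x / n) ^ n \<le> exp x"
proof -
  have "(1 + x / n) ^ n \<le> exp (x / n) ^ n" using assms by (intro power_mono) auto
  also have "\<dots> = exp x" using assms by (simp flip: exp_of_nat_mult)
  finally show ?thesis .
qed

context saddle
begin

text \<open>This is the mass of the central Gaussian after the change of variable, without
  \<open>52/100\<close>. The exponent expands into a displacement term of at most
  \<open>pi/4\<close>, a term linear in \<open>\<sigma>\<close>, and a small
  \<open>\<sigma>^2\<close> term. The linear term joins \<open>(a/q) powr \<sigma>\<close> to form
  \<open>X powr \<sigma>\<close>.\<close>

lemma central_mass_le:
  "q / sqrt (a^2 + q^2) * (a/q) powr \<sigma> *
     exp ((2*pi*(a^2 - q^2) - \<sigma>)^2 / (4 * (2*pi*(a^2 + q^2)))) \<le> 224/100 * (782/1000)"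
proof -
  define S where "S = a^2 + q^2"
  define X where "X = a / q * exp (- (a^2 - q^2) / (2 * S))"
  have q2: "9/4 \<le> q^2" using power_mono[OF q, of 2] by (simp add: power_divide)
  have a2: "16/25 * q^2 \<le> a^2" using power_mono[OF aq(1), of 2] pos by (simp add: power_mult_distrib power_divide)
  have S: "S \<ge> 369/100" using q2 a2 unfolding S_def by linarith
  have X0: "X > 0" unfolding X_def using pos by simp
  have "(2*pi*(a^2 - q^2) - \<sigma>)^2 / (4 * (2*pi*S))
      = pi/2 * ((a^2 - q^2)^2 / S) - \<sigma> * ((a^2 - q^2) / (2 * S)) + \<sigma>^2 / (8 * pi * S)"
    using S by (simp add: divide_simps power2_eq_square) (simp add: algebra_simps)
  also have "\<dots> \<le> pi/2 * (1/2) - \<sigma> * ((a^2 - q^2) / (2 * S)) + 11/1000"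
  proof (intro add_mono diff_mono mult_left_mono order_refl)
    have "(a^2 - q^2)^2 = (a - q)^2 * (a + q)^2" by algebra
    also have "\<dots> \<le> (1/2)^2 * (2 * S)"
    proof (rule mult_mono)
      show "(a - q)^2 \<le> (1/2)^2" using aq(2) by (subst abs_le_square_iff[symmetric]) simp
      have "(a + q)^2 + (a - q)^2 = 2 * S" unfolding S_def by algebra
      then show "(a + q)^2 \<le> 2 * S" by (smt (verit) zero_le_power2)
    qed auto
    finally show "(a^2 - q^2)^2 / S \<le> 1/2" using S by (simp add: divide_simps power2_eq_square)
    have "\<sigma>^2 \<le> 1" using sigma by (simp add: power_le_one)
    moreover have "8 * (314/100) * (369/100) \<le> 8 * pi * S" using S pi_approx by (intro mult_mono) auto
    ultimately have "\<sigma>^2 \<le> 11/1000 * (8 * pi * S)" by linarith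
    then show "\<sigma>^2 / (8 * pi * S) \<le> 11/1000" using S by (simp add: pos_divide_le_eq)
  qed (use sigma in auto)
  also have "\<dots> = (pi/4 + 11/1000) + \<sigma> * (- (a^2 - q^2) / (2 * S))"
    unfolding minus_divide_left[symmetric] by simp
  also have "\<dots> \<le> 797/1000 + \<sigma> * (- (a^2 - q^2) / (2 * S))"
    using pi_approx by (intro add_right_mono) simp
  finally have "exp ((2*pi*(a^2 - q^2) - \<sigma>)^2 / (4 * (2*pi*S)))
      \<le> exp (797/1000) * exp (- (a^2 - q^2) / (2 * S)) powr \<sigma>"
    by (simp add: exp_powr_real mult.commute flip: exp_add)
  also have "\<dots> \<le> 224/100 * exp (- (a^2 - q^2) / (2 * S)) powr \<sigma>"
  proof (rule mult_right_mono)
    have "exp (797/1000) \<le> exp (4/5 :: real)" by simp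
    also have "\<dots> \<le> 224/100" using exp_le_inverse_power[of "4/5" 64] by (simp add: power_divide divide_simps)
    finally show "exp (797/1000) \<le> (224/100 :: real)" .
  qed simp
  finally have 1: "exp ((2*pi*(a^2 - q^2) - \<sigma>)^2 / (4 * (2*pi*S)))
      \<le> 224/100 * exp (- (a^2 - q^2) / (2 * S)) powr \<sigma>" .
  have 2: "q / sqrt S * X powr \<sigma> \<le> 782/1000"
  proof -
    have i: "q / sqrt S \<le> 782/1000"
    proof (rule power2_le_imp_le)
      have "q^2 \<le> (782/1000)^2 * S" using a2 q2 unfolding S_def by (simp add: power_divide)
      then show "(q / sqrt S)^2 \<le> (782/1000)^2" using S by (simp add: power_divide pos_divide_le_eq)
    qed simp
    \<comment> \<open>With \<open>p = a^2 / S\<close> the square is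
      \<open>p * exp (- (2*p - 1))\<close>, which is at most \<open>1/2\<close> since
      \<open>2*p \<le> exp (2*p - 1)\<close>.\<close>
    have ii: "q / sqrt S * X \<le> 782/1000"
    proof (rule power2_le_imp_le)
      have "1 + (2 * a^2 / S - 1) \<le> exp (2 * a^2 / S - 1)" by (rule exp_ge_add_one_self)
      then have "2 * (a^2 / S) * exp (- (2 * a^2 / S - 1)) \<le> 1"
        using mult_right_mono[of "2 * a^2 / S" "exp (2 * a^2 / S - 1)" "exp (- (2 * a^2 / S - 1))"]
        by (simp flip: exp_add)
      moreover have "2 * a^2 / S - 1 = (a^2 - q^2) / S"
      proof -
        have "a^2 - q^2 = 2 * a^2 - S" by (simp add: S_def)
        then show ?thesis using S by (simp only: diff_divide_distrib) simp
      qed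
      moreover have "(q / sqrt S * X)^2 = (a^2 / S) * exp (- ((a^2 - q^2) / S))"
      proof -
        have "q / sqrt S * X = a / sqrt S * exp (- (a^2 - q^2) / (2 * S))"
          unfolding X_def using pos by simp
        then have "(q / sqrt S * X)^2 = (a / sqrt S)^2 * exp (2 * (- (a^2 - q^2) / (2 * S)))"
          by (simp only: power_mult_distrib exp_double)
        moreover have "2 * (- x / (2 * S)) = - (x / S)" for x by simp
        ultimately show ?thesis using S by (simp only:) (simp add: power_divide)
      qed
      ultimately have "2 * (q / sqrt S * X)^2 \<le> 1" by (simp add: mult_ac)
      moreover have "(1/2 :: real) \<le> (782/1000)^2" by (simp add: power_divide)
      ultimately show "(q / sqrt S * X)^2 \<le> (782/1000)^2" by linarith
    qed simp
    \<comment> \<open>\<open>X powr \<sigma>\<close> lies below the larger of its values at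
      \<open>\<sigma> = 0\<close> and \<open>\<sigma> = 1\<close>, which are covered by
      \<open>i\<close> and \<open>ii\<close>.\<close>
    show ?thesis
    proof (cases "X \<ge> 1")
      case True
      then have "X powr \<sigma> \<le> X powr 1" using sigma by (intro powr_mono) auto
      then have "q / sqrt S * X powr \<sigma> \<le> q / sqrt S * X" using X0 pos S by (intro mult_left_mono) auto
      then show ?thesis using ii by linarith
    next
      case False
      then have "X powr \<sigma> \<le> 1 powr \<sigma>" using sigma X0 by (intro powr_mono2) auto
      then have "q / sqrt S * X powr \<sigma> \<le> q / sqrt S * 1" using X0 pos S by (intro mult_left_mono) auto
      then show ?thesis using i by linarith
    qed
  qed
  have "q / sqrt S * (a/q) powr \<sigma> * exp ((2*pi*(a^2 - q^2) - \<sigma>)^2 / (4 * (2*pi*S)))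
     \<le> q / sqrt S * (a/q) powr \<sigma> * (224/100 * exp (- (a^2 - q^2) / (2 * S)) powr \<sigma>)"
    using 1 pos S by (intro mult_left_mono) auto
  also have "\<dots> = 224/100 * (q / sqrt S * X powr \<sigma>)"
    unfolding X_def using pos powr_mult[of "a/q" "exp (- (a^2 - q^2) / (2 * S))" \<sigma>] by simp
  also have "\<dots> \<le> 224/100 * (782/1000)" using 2 by (intro mult_left_mono) auto
  finally show ?thesis unfolding S_def .
qed

lemma left_mass_le: "exp (- (pi/2) * (pi * a^2 - q^2)) \<le> 1/30"
proof -
  have q2: "9/4 \<le> q^2" using power_mono[OF q, of 2] by (simp add: power_divide)
  have a2: "16/25 * q^2 \<le> a^2" using power_mono[OF aq(1), of 2] pos by (simp add: power_mult_distrib power_divide)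
  have "314/100 * (16/25 * q^2) \<le> pi * a^2" using a2 pi_approx by (intro mult_mono) auto
  then have "227/100 \<le> pi * a^2 - q^2" using q2 by linarith
  then have "(314/100/2) * (227/100) \<le> (pi/2) * (pi * a^2 - q^2)"
    using pi_approx by (intro mult_mono) auto
  then have "exp (7/2) \<le> exp ((pi/2) * (pi * a^2 - q^2))" by simp
  moreover have "(30::real) \<le> exp (7/2)"
    by (rule order_trans[OF _ exp_ge_power[of "7/2" 70]]) (simp_all add: power_divide)
  ultimately have "30 \<le> exp ((pi/2) * (pi * a^2 - q^2))" by linarith
  then show ?thesis by (simp add: exp_minus divide_simps)
qed

text \<open>A sum instead of a case distinction: the Gaussian is kept on the whole line so that its
  integral has a closed form, and nonnegativity of the terms makes the sum dominate on each
  piece.\<close>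

definition majorant :: "real \<Rightarrow> real" where
  "majorant y = 52/100 * (a/q) powr \<sigma> * exp ((2*pi*(a^2 - q^2) - \<sigma>) * y - 2*pi*(a^2 + q^2) * y^2) +
     10/33 * (indicator {1/(2*q)..} y * exp (- (2*pi*q) * (y - 1/(2*q)))) +
     2/3 * sqrt 2 * exp (- (pi/2) * (pi * a^2 - q^2)) *
       (indicator {..- (1/2)} y * exp (- (2*pi*q^2) * (y - - (1/2))^2))"

lemma scaled_integrand_le_majorant: "scaled_integrand y \<le> majorant y"
proof -
  define T1 where "T1 = 52/100 * (a/q) powr \<sigma> * exp ((2*pi*(a^2 - q^2) - \<sigma>) * y - 2*pi*(a^2 + q^2) * y^2)"
  define T2 where "T2 = 10/33 * (indicator {1/(2*q)..} y * exp (- (2*pi*q) * (y - 1/(2*q))))"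
  define T3 where "T3 = 2/3 * sqrt 2 * exp (- (pi/2) * (pi * a^2 - q^2)) *
       (indicator {..- (1/2)} y * exp (- (2*pi*q^2) * (y - - (1/2))^2))"
  have majorant: "majorant y = T1 + T2 + T3" unfolding majorant_def T1_def T2_def T3_def ..
  have nonneg: "0 \<le> T1" "0 \<le> T2" "0 \<le> T3" by (simp_all add: T1_def T2_def T3_def)
  consider "- (1/2) \<le> y" "y \<le> 1/(2*q)" | "1/(2*q) \<le> y" | "y \<le> - (1/2)" by linarith
  then show ?thesis
  proof cases
    case 1
    then show ?thesis using scaled_integrand_le_central[OF 1] nonneg unfolding majorant T1_def by linarith
  next
    case 2
    have "- 2*pi*(q*y - 1/2) = - (2*pi*q) * (y - 1/(2*q))" using pos by (simp add: field_simps)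
    then have "scaled_integrand y \<le> T2" using scaled_integrand_le_right[OF 2] 2 by (simp add: T2_def mult.assoc)
    then show ?thesis using nonneg unfolding majorant by linarith
  next
    case 3
    then have "scaled_integrand y \<le> T3" using scaled_integrand_le_left[OF 3] by (simp add: T3_def)
    then show ?thesis using nonneg unfolding majorant by linarith
  qed
qed

text \<open>\<open>sqrt 2 * q\<close> is the Jacobian of the substitution
  \<open>u = sqrt 2 * q * y\<close>, where \<open>u\<close> is arc length along the line.\<close>

lemma majorant_integral:
  "integrable lborel majorant" "sqrt 2 * q * integral\<^sup>L lborel majorant \<le> 1"
proof -
  let ?E = "exp (- (pi/2) * (pi * a^2 - q^2))"
  let ?G = "exp ((2*pi*(a^2 - q^2) - \<sigma>)^2 / (4 * (2*pi*(a^2 + q^2))))"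
  have S: "a^2 + q^2 > 0" using pos by (simp add: add_pos_pos)
  have majorant: "has_bochner_integral lborel majorant
    (52/100 * (a/q) powr \<sigma> * (sqrt (pi / (2*pi*(a^2 + q^2))) * ?G) + 10/33 * (1 / (2*pi*q)) +
     2/3 * sqrt 2 * ?E * (sqrt (pi / (2*pi*q^2)) / 2))" (is "has_bochner_integral _ _ ?I")
    unfolding majorant_def using pos S
    by (intro has_bochner_integral_add has_bochner_integral_mult_right has_bochner_integral_gaussian
          has_bochner_integral_gaussian_left has_bochner_integral_exp_right) auto
  then show "integrable lborel majorant" by (rule integrable.intros)
  have e1: "sqrt 2 * sqrt (pi / (2*pi*(a^2 + q^2))) = 1 / sqrt (a^2 + q^2)"
    unfolding real_sqrt_mult real_sqrt_divide by simp
  have e2: "sqrt 2 * q * sqrt (pi / (2*pi*q^2)) = 1"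
    using pos unfolding real_sqrt_mult real_sqrt_divide by simp
  have e3: "q * (1 / (2*pi*q)) = 1 / (2*pi)" using pos by simp
  have "sqrt 2 * q * ?I = 52/100 * (q * (sqrt 2 * sqrt (pi / (2*pi*(a^2 + q^2)))) * (a/q) powr \<sigma> * ?G) +
      10/33 * sqrt 2 * (q * (1 / (2*pi*q))) + sqrt 2 / 3 * ?E * (sqrt 2 * q * sqrt (pi / (2*pi*q^2)))"
    by (simp only: ring_distribs mult_ac)
  also have "\<dots> = 52/100 * (q / sqrt (a^2 + q^2) * (a/q) powr \<sigma> * ?G) + 10/33 * sqrt 2 / (2 * pi) + sqrt 2 / 3 * ?E"
    unfolding e1 e2 e3 by simp
  \<comment> \<open>The three terms are about 0.911, 0.069 and 0.016.\<close>
  also have "\<dots> \<le> 52/100 * (224/100 * (782/1000)) + 69/1000 + 1415/3000 * (1/30)"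
  proof (intro add_mono mult_left_mono[OF central_mass_le] mult_mono[OF _ left_mass_le])
    have s: "sqrt 2 \<le> 1415/1000" by (rule real_le_lsqrt) (simp_all add: power_divide)
    then show "sqrt 2 / 3 \<le> 1415/3000" by simp
    have "10/33 * sqrt 2 / (2 * pi) \<le> 10/33 * (1415/1000) / (2 * (314/100))"
      using s pi_approx by (intro frac_le mult_left_mono) auto
    also have "\<dots> \<le> 69/1000" by simp
    finally show "10/33 * sqrt 2 / (2 * pi) \<le> 69/1000" .
  qed auto
  also have "\<dots> \<le> 1" by simp
  finally show "sqrt 2 * q * integral\<^sup>L lborel majorant \<le> 1"
    using has_bochner_integral_integral_eq[OF majorant] by simp
qed

lemma norm_integral_le:
  fixes f :: "real \<Rightarrow> complex"
  assumes "f \<in> borel_measurable lborel" "\<And>u. norm (f u) \<le> scaled_integrand (u / (sqrt 2 * q))"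
  shows "integrable lborel f" "norm (integral\<^sup>L lborel f) \<le> 1"
proof -
  let ?majorant = "\<lambda>u. majorant (u / (sqrt 2 * q))"
  have c: "1 / (sqrt 2 * q) > 0" using pos by simp
  have iH: "integrable lborel ?majorant"
    using lborel_integrable_real_affine[OF majorant_integral(1), of "1 / (sqrt 2 * q)" 0] c pos by simp
  have le: "norm (f u) \<le> ?majorant u" for u using assms(2)[of u] scaled_integrand_le_majorant order_trans by blast
  then have "norm (f u) \<le> norm (?majorant u)" for u by (smt (verit) real_norm_def)
  then show "integrable lborel f" by (intro Bochner_Integration.integrable_bound[OF iH assms(1)]) auto
  have "norm (integral\<^sup>L lborel f) \<le> integral\<^sup>L lborel ?majorant"
    by (rule Bochner_Integration.integral_norm_bound_integral[OF \<open>integrable lborel f\<close> iH]) (use le in auto)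
  also have "\<dots> = sqrt 2 * q * integral\<^sup>L lborel majorant"
    using lborel_integral_real_affine[of "1 / (sqrt 2 * q)" majorant 0] c pos by simp
  also have "\<dots> \<le> 1" by (rule majorant_integral)
  finally show "norm (integral\<^sup>L lborel f) \<le> 1" .
qed

end

section \<open>Moving the line of integration\<close>

text \<open>On the compact middle part the maximum is multiplied by \<open>exp (pi * U^2)\<close>,
  so that a single Gaussian dominates everywhere.\<close>

lemma integrable_if_gaussian_decay:
  fixes g :: "real \<Rightarrow> complex"
  assumes cont: "continuous_on UNIV g" and decay: "\<And>u. U \<le> \<bar>u\<bar> \<Longrightarrow> norm (g u) \<le> K * exp (- pi * u^2)"
  shows "integrable lborel g"
proof -
  have "compact (g ` {-U..U})"
    by (intro compact_continuous_image continuous_on_subset[OF cont]) auto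
  then obtain M where M: "\<And>u. u \<in> {-U..U} \<Longrightarrow> norm (g u) \<le> M"
    by (meson compact_imp_bounded bounded_iff imageI)
  have *: "norm (g u) \<le> (\<bar>K\<bar> + \<bar>M\<bar> * exp (pi * U^2)) * exp (0 * u - pi * u^2)" for u
  proof (cases "U \<le> \<bar>u\<bar>")
    case True
    have "norm (g u) \<le> K * exp (- pi * u^2)" by (rule decay[OF True])
    also have "\<dots> \<le> (\<bar>K\<bar> + \<bar>M\<bar> * exp (pi * U^2)) * exp (- pi * u^2)"
      by (intro mult_right_mono) (auto intro: add_increasing2)
    finally show ?thesis by simp
  next
    case False
    then have u: "u \<in> {-U..U}" "u^2 \<le> U^2" by (auto simp: abs_le_square_iff[symmetric])
    have "norm (g u) \<le> \<bar>M\<bar> * 1" using M[OF u(1)] by simp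
    also have "\<dots> \<le> \<bar>M\<bar> * (exp (pi * U^2) * exp (- pi * u^2))"
      using u(2) by (intro mult_left_mono) (simp_all flip: exp_add)
    also have "\<dots> \<le> (\<bar>K\<bar> + \<bar>M\<bar> * exp (pi * U^2)) * exp (- pi * u^2)"
      by (simp add: algebra_simps)
    finally show ?thesis by simp
  qed
  have "integrable lborel (\<lambda>u. (\<bar>K\<bar> + \<bar>M\<bar> * exp (pi * U^2)) * exp (0 * u - pi * u^2))"
    by (intro integrable_mult_right integrable.intros[OF has_bochner_integral_gaussian]) simp
  then show ?thesis
  proof (rule Bochner_Integration.integrable_bound)
    show "g \<in> borel_measurable lborel" using borel_measurable_continuous_onI[OF cont] by simp
  qed (use * in \<open>auto intro!: AE_I2 order_trans[OF *]\<close>)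
qed

text \<open>Bridge from the Henstock-Kurzweil integrals that vertical contour segments produce to
  the Lebesgue integral over the whole line; \<open>norm (g u)\<close> serves as the dominating
  function.\<close>

lemma tendsto_integral_symmetric_interval:
  fixes g :: "real \<Rightarrow> complex"
  assumes "integrable lborel g"
  shows "((\<lambda>U. integral {-U..U} g) \<longlongrightarrow> integral\<^sup>L lborel g) at_top"
proof -
  have eq: "integral {-U..U} g = (\<integral>u. indicator {-U..U} u *\<^sub>R g u \<partial>lborel)" for U
  proof -
    have "set_integrable lborel {-U..U} g" unfolding set_integrable_def
      by (intro integrable_mult_indicator assms) simp
    then show ?thesis using set_borel_integral_eq_integral(2)[of "{-U..U}" g] by (simp add: set_lebesgue_integral_def)
  qed
  have "((\<lambda>U. \<integral>u. indicator {-U..U} u *\<^sub>R g u \<partial>lborel) \<longlongrightarrow> integral\<^sup>L lborel g) at_top"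
  proof (rule integral_dominated_convergence_at_top[where w = "\<lambda>u. norm (g u)"])
    show "AE u in lborel. ((\<lambda>U. indicator {-U..U} u *\<^sub>R g u) \<longlongrightarrow> g u) at_top"
    proof (intro AE_I2 tendsto_eventually)
      fix u show "\<forall>\<^sub>F U in at_top. indicator {-U..U} u *\<^sub>R g u = g u"
        using eventually_ge_at_top[of "\<bar>u\<bar>"] by eventually_elim (auto simp: indicator_def)
    qed
  qed (use assms in \<open>auto simp: indicator_def intro!: always_eventually AE_I2\<close>)
  then show ?thesis unfolding eq .
qed

text \<open>In the coordinate \<open>w = exp (\<pi> \<i> / 4) x\<close> the lines of integration are vertical.\<close>

definition rotated_integrand :: "complex \<Rightarrow> complex \<Rightarrow> complex" where
  "rotated_integrand s w = riemann_aux_integrand s (cis (- (pi/4)) * w)"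

lemma Re_Im_rotated:
  "Re (cis (- (pi/4)) * w) = (Re w + Im w) / sqrt 2" "Im (cis (- (pi/4)) * w) = (Im w - Re w) / sqrt 2"
  by (simp_all add: cos_45 sin_45 field_simps)

lemma cis_mult_cis_uminus: "cis (- b) * (cis b * z) = z" "cis b * (cis (- b) * z) = z"
  by (simp_all add: cis_mult flip: mult.assoc)

lemma sinh_square_ge: "y^2 \<le> (sinh y)^2" for y :: real
proof -
  have "0 \<le> sinh \<bar>y\<bar> - \<bar>y\<bar>"
  proof (rule nonneg_if_deriv_nonneg[where f = "\<lambda>x. sinh x - x" and f' = "\<lambda>x. cosh x - 1"])
    show "((\<lambda>x. sinh x - x) has_real_derivative cosh x - 1) (at x)" for x :: real
      by (auto intro!: derivative_eq_intros)
  qed (auto simp: cosh_real_ge_1)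
  then have "\<bar>y\<bar> \<le> \<bar>sinh y\<bar>" by simp
  then show ?thesis by (simp only: abs_le_square_iff)
qed

text \<open>In this coordinate \<open>- (2 * pi * Re x * Im x)\<close> becomes
  \<open>pi * (v^2 - u^2)\<close>. The bound is uniform over the strip, so it gives both
  integrability on vertical lines and the vanishing of horizontal edges.\<close>

lemma norm_rotated_integrand_le:
  assumes "0 \<le> Re s" "0 < v0" "v0 \<le> v" "v \<le> v1" "v1 + 1 \<le> \<bar>u\<bar>"
  shows "norm (rotated_integrand s (Complex v u))
    \<le> v0 powr (- Re s) * exp (\<bar>Im s\<bar> * pi + pi * v1^2) * exp (- pi * u^2)"
proof -
  let ?w = "Complex v u" let ?x = "cis (- (pi/4)) * ?w"
  have "?w \<noteq> 0" using assms by (auto simp: complex_eq_iff)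
  then have x0: "?x \<noteq> 0" by simp
  have "v0 \<le> \<bar>Re ?w\<bar>" using assms by simp
  also have "\<dots> \<le> cmod ?x" using abs_Re_le_cmod[of ?w] by (simp add: norm_mult)
  finally have 1: "cmod ?x powr (- Re s) \<le> v0 powr (- Re s)"
    using assms by (intro powr_mono2') auto
  have "Im s * Arg ?x \<le> \<bar>Im s\<bar> * \<bar>Arg ?x\<bar>" by (metis abs_ge_self abs_mult)
  also have "\<dots> \<le> \<bar>Im s\<bar> * pi" using Arg_bounded[of ?x] by (intro mult_left_mono) auto
  finally have 2: "exp (Im s * Arg ?x) \<le> exp (\<bar>Im s\<bar> * pi)" by simp
  have "- (2 * pi * Re ?x * Im ?x) = pi * v^2 - pi * u^2"
    unfolding Re_Im_rotated by (simp add: power2_eq_square field_simps)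
  also have "\<dots> \<le> pi * v1^2 + - pi * u^2" using assms by (simp add: power_mono)
  finally have 3: "exp (- (2 * pi * Re ?x * Im ?x)) \<le> exp (pi * v1^2) * exp (- pi * u^2)"
    by (simp flip: exp_add)
  \<comment> \<open>The distance \<open>\<bar>u - v\<bar> \<ge> 1\<close> from the diagonal, which
    contains all poles, makes \<open>sinh\<close> large enough.\<close>
  have 4: "1 \<le> 2 * sqrt ((sin (pi * Re ?x))^2 + (sinh (pi * Im ?x))^2)"
  proof -
    have "1 \<le> \<bar>u - v\<bar>" using assms by linarith
    then have "1 \<le> (u - v)^2" by (metis abs_1 abs_le_square_iff one_power2)
    then have "1/2 \<le> (Im ?x)^2" unfolding Re_Im_rotated by (simp add: power_divide)
    moreover have "(Im ?x)^2 \<le> (pi * Im ?x)^2"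
      using pi_ge_two by (subst abs_le_square_iff[symmetric]) (simp add: abs_mult mult_right_mono[of 1 pi, simplified])
    moreover have "(pi * Im ?x)^2 \<le> (sinh (pi * Im ?x))^2" by (rule sinh_square_ge)
    moreover have "0 \<le> (sin (pi * Re ?x))^2" by simp
    ultimately have "1/4 \<le> (sin (pi * Re ?x))^2 + (sinh (pi * Im ?x))^2"
      by linarith
    then have "sqrt (1/4) \<le> sqrt ((sin (pi * Re ?x))^2 + (sinh (pi * Im ?x))^2)" by (rule real_sqrt_le_mono)
    then show ?thesis by (simp add: real_sqrt_divide)
  qed
  have "norm (rotated_integrand s ?w) = cmod ?x powr (- Re s) * exp (Im s * Arg ?x) * exp (- (2 * pi * Re ?x * Im ?x)) /
    (2 * sqrt ((sin (pi * Re ?x))^2 + (sinh (pi * Im ?x))^2))"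
    unfolding rotated_integrand_def by (rule norm_riemann_aux_integrand[OF x0])
  also have "\<dots> \<le> (v0 powr (- Re s) * exp (\<bar>Im s\<bar> * pi) * (exp (pi * v1^2) * exp (- pi * u^2))) / 1"
    using 1 2 3 4 by (intro frac_le mult_mono) auto
  finally show ?thesis by (simp add: exp_add mult_ac)
qed

lemma riemann_aux_denominator_eq_0_iff:
  "exp (of_real pi * \<i> * x) = exp (- (of_real pi * \<i> * x)) \<longleftrightarrow> x \<in> \<int>"
proof -
  have "exp (of_real pi * \<i> * x) - exp (- (of_real pi * \<i> * x)) = 2 * \<i> * sin (of_real pi * x)"
    by (simp add: sin_exp_eq' mult_ac)
  then have "exp (of_real pi * \<i> * x) = exp (- (of_real pi * \<i> * x)) \<longleftrightarrow> sin (of_real pi * x) = 0"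
    by (metis mult_eq_0_iff right_minus_eq complex_i_not_zero zero_neq_numeral)
  then show ?thesis
    using sin_eq_0[of "of_real pi * x"] by (auto simp: Ints_def)
qed

text \<open>A real \<open>x\<close> corresponds to \<open>Re w = Im w\<close>; then
  \<open>Re w > 0\<close> makes \<open>x\<close> positive. The right half-plane thus avoids the
  branch cut.\<close>

lemma rotated_mem_nonpos_Reals:
  assumes "Re w > 0" shows "cis (- (pi/4)) * w \<notin> \<real>\<^sub>\<le>\<^sub>0"
proof
  assume "cis (- (pi/4)) * w \<in> \<real>\<^sub>\<le>\<^sub>0"
  then have "Re (cis (- (pi/4)) * w) \<le> 0" "Im (cis (- (pi/4)) * w) = 0"
    by (auto simp: complex_nonpos_Reals_iff)
  then show False unfolding Re_Im_rotated using assms by (simp add: divide_le_0_iff)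
qed

lemma holomorphic_rotated_integrand:
  assumes "\<And>w. w \<in> A \<Longrightarrow> Re w > 0" "\<And>w n. w \<in> A \<Longrightarrow> n > 0 \<Longrightarrow> w \<noteq> of_nat n * cis (pi/4)"
  shows "rotated_integrand s holomorphic_on A"
proof -
  have "cis (- (pi/4)) * w \<notin> \<int>" if "w \<in> A" for w
  proof
    assume "cis (- (pi/4)) * w \<in> \<int>"
    then obtain k where k: "cis (- (pi/4)) * w = of_int k" by (auto elim: Ints_cases)
    have "w = cis (pi/4) * (cis (- (pi/4)) * w)" by (simp only: cis_mult_cis_uminus)
    then have w: "w = of_int k * cis (pi/4)" unfolding k by (simp add: mult.commute)
    have "k > 0" using assms(1)[OF that] unfolding w by (simp add: cos_45 zero_less_mult_iff)
    then show False using assms(2)[OF that, of "nat k"] w by simp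
  qed
  then show ?thesis
    unfolding rotated_integrand_def riemann_aux_integrand_def
    using rotated_mem_nonpos_Reals assms(1)
    by (intro holomorphic_intros) (auto simp: riemann_aux_denominator_eq_0_iff)
qed

text \<open>At \<open>x = n\<close> the numerator carries the sign \<open>(-1)^(n^2)\<close> and the
  derivative of the denominator the sign \<open>(-1)^n\<close>; these agree and cancel. The factor
  \<open>cis (pi/4)\<close> comes from the chain rule for the rotation.\<close>

lemma residue_rotated_integrand:
  assumes "n > 0"
  shows "residue (rotated_integrand s) (of_nat n * cis (pi/4)) = cis (pi/4) * (1 / of_nat n powr s) / (2 * of_real pi * \<i>)"
proof -
  let ?w = "of_nat n * cis (pi/4)" and ?x = "\<lambda>w. cis (- (pi/4)) * w"
  let ?num = "\<lambda>w. ?x w powr (-s) * exp (of_real pi * \<i> * (?x w)^2)"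
  let ?den = "\<lambda>w. exp (of_real pi * \<i> * ?x w) - exp (- (of_real pi * \<i> * ?x w))"
  have x: "?x ?w = of_nat n" using cis_mult_cis_uminus(1)[of "pi/4" "of_nat n"] by (simp add: mult_ac)
  have e: "exp (of_real pi * \<i> * of_nat n) = (-1) ^ n"
    using exp_of_nat_mult[of n "of_real pi * \<i>"] by (simp add: mult_ac exp_pi_i')
  have e2: "exp (- (of_real pi * \<i> * of_nat n)) = (-1) ^ n"
    unfolding exp_minus e by (simp add: power_inverse[symmetric])
  have e3: "exp (of_real pi * \<i> * (of_nat n)^2) = (-1) ^ n"
  proof -
    have "exp (of_real pi * \<i> * (of_nat n)^2) = exp (of_real pi * \<i> * of_nat n) ^ n"
      by (simp add: power2_eq_square mult_ac flip: exp_of_nat_mult)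
    also have "\<dots> = (-1) ^ (n * n)" unfolding e by (simp add: power_mult)
    also have "\<dots> = (-1) ^ n" by (cases "even n") auto
    finally show ?thesis .
  qed
  have "residue (\<lambda>w. ?num w / ?den w) ?w = ?num ?w / (2 * of_real pi * \<i> * cis (- (pi/4)) * (-1) ^ n)"
  proof (rule residue_simple_pole_deriv[where s = "{w. Re w > 0}"])
    show "open {w. Re w > 0}" by (rule open_halfspace_Re_gt)
    show "connected {w. Re w > 0}" by (intro convex_connected convex_halfspace_Re_gt)
    show "?num holomorphic_on {w. Re w > 0}" using rotated_mem_nonpos_Reals by (intro holomorphic_intros) auto
    show "?den holomorphic_on {w. Re w > 0}" by (intro holomorphic_intros)
    show "?num ?w \<noteq> 0" using assms unfolding x by simp
    show "?w \<in> {w. Re w > 0}" using assms by (simp add: cos_45)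
    show "?den ?w = 0" unfolding x e e2 by simp
    have "(?den has_field_derivative (of_real pi * \<i> * cis (- (pi/4))) * exp (of_real pi * \<i> * ?x ?w)
        + (of_real pi * \<i> * cis (- (pi/4))) * exp (- (of_real pi * \<i> * ?x ?w))) (at ?w)"
      by (auto intro!: derivative_eq_intros)
    then show "(?den has_field_derivative 2 * of_real pi * \<i> * cis (- (pi/4)) * (-1) ^ n) (at ?w)"
      unfolding x e e2 by (simp add: algebra_simps)
  qed auto
  also have "\<dots> = of_nat n powr (-s) / (2 * of_real pi * \<i> * cis (- (pi/4)))"
    unfolding x e3 by simp
  also have "\<dots> = cis (pi/4) * (1 / of_nat n powr s) / (2 * of_real pi * \<i>)"
    by (simp add: powr_minus_divide cis_divide divide_simps) (simp add: cis_mult)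
  finally show ?thesis unfolding rotated_integrand_def riemann_aux_integrand_def .
qed


lemma Re_Im_pole: "Re (of_nat n * cis (pi/4)) = real n / sqrt 2" "Im (of_nat n * cis (pi/4)) = real n / sqrt 2"
proof -
  have "cos (pi/4) = 1 / sqrt 2" "sin (pi/4) = 1 / sqrt 2"
    by (simp_all add: cos_45 sin_45 divide_simps)
  then show "Re (of_nat n * cis (pi/4)) = real n / sqrt 2" "Im (of_nat n * cis (pi/4)) = real n / sqrt 2"
    by simp_all
qed

text \<open>Integration is with respect to \<open>u\<close>; the contour integral along the upward
  vertical line is \<open>\<i>\<close> times this.\<close>

definition rotated_line_integral :: "complex \<Rightarrow> real \<Rightarrow> complex" where
  "rotated_line_integral s v = (\<integral>u. rotated_integrand s (Complex v u) \<partial>lborel)"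

lemma continuous_rotated_line:
  assumes "v > 0" "\<And>n. v \<noteq> real n / sqrt 2"
  shows "continuous_on A (\<lambda>u. rotated_integrand s (Complex v u))"
proof -
  have "rotated_integrand s holomorphic_on {w. Re w = v}"
    proof (rule holomorphic_rotated_integrand)
    show "w \<noteq> of_nat n * cis (pi/4)" if "w \<in> {w. Re w = v}" for w n
      using that assms(2)[of n] Re_Im_pole(1)[of n] by auto
  qed (use assms in auto)
  then have "continuous_on {w. Re w = v} (rotated_integrand s)"
    by (rule holomorphic_on_imp_continuous_on)
  moreover have "continuous_on A (Complex v)" by (auto intro!: continuous_intros simp: Complex_eq)
  ultimately show ?thesis by (rule continuous_on_compose2) auto
qed

lemma integrable_rotated_line:
  assumes "0 \<le> Re s" "v > 0" "\<And>n. v \<noteq> real n / sqrt 2"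
  shows "integrable lborel (\<lambda>u. rotated_integrand s (Complex v u))"
proof (rule integrable_if_gaussian_decay)
  show "continuous_on UNIV (\<lambda>u. rotated_integrand s (Complex v u))"
    using assms by (intro continuous_rotated_line)
  show "norm (rotated_integrand s (Complex v u)) \<le> v powr (- Re s) * exp (\<bar>Im s\<bar> * pi + pi * v^2) * exp (- pi * u^2)"
    if "v + 1 \<le> \<bar>u\<bar>" for u using assms that by (intro norm_rotated_integrand_le) auto
qed

text \<open>The poles \<open>n * cis (pi/4)\<close> have real and imaginary part
  \<open>n / sqrt 2\<close>, so the rectangle encloses exactly those with
  \<open>1 \<le> n \<le> N\<close>, each with winding number 1.\<close>

lemma contour_integral_rectpath_rotated:
  assumes v: "0 < v0" "v0 < 1 / sqrt 2" "real N / sqrt 2 < v1" "v1 < real (Suc N) / sqrt 2" "v0 < v1"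
    and U: "real N + 1 \<le> U"
  shows "contour_integral (rectpath (Complex v0 (-U)) (Complex v1 U)) (rotated_integrand s)
    = cis (pi/4) * (\<Sum>n\<in>{1..N}. 1 / of_nat n powr s)"
proof -
  \<comment> \<open>The strip stops short of 0 and of the pole number \<open>N + 1\<close>, so only
    finitely many singularities remain in it.\<close>
  define S where "S = {w. 0 < Re w \<and> Re w < real (Suc N) / sqrt 2}"
  define p where "p = (\<lambda>n. of_nat n * cis (pi/4))"
  let ?R = "rectpath (Complex v0 (-U)) (Complex v1 U)" and ?F = "rotated_integrand s"
  have Re_p: "Re (p n) = real n / sqrt 2" "Im (p n) = real n / sqrt 2" for n
    unfolding p_def by (rule Re_Im_pole)+
  have inj: "inj p" by (rule injI) (metis Re_p(1) divide_cancel_right of_nat_eq_iff real_sqrt_eq_zero_cancel_iff zero_neq_numeral)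
  have Scbox: "cbox (Complex v0 (-U)) (Complex v1 U) \<subseteq> S"
    using v by (auto simp: S_def in_cbox_complex_iff)
  have box: "p n \<in> box (Complex v0 (-U)) (Complex v1 U)" if "n \<in> {1..N}" for n
  proof -
    have "1 / sqrt 2 \<le> real n / sqrt 2" "real n / sqrt 2 \<le> real N / sqrt 2"
      using that by (auto intro!: divide_right_mono)
    moreover have "real n / sqrt 2 \<le> real n"
      using mult_left_mono[of 1 "sqrt 2" "real n"] by (simp add: divide_le_eq)
    moreover have "real n \<le> real N" "0 \<le> real n / sqrt 2" using that by auto
    ultimately show ?thesis
      using v U by (simp add: in_box_complex_iff Re_p)
  qed
  have "contour_integral ?R ?F = 2 * pi * \<i> * (\<Sum>w\<in>p ` {1..N}. winding_number ?R w * residue ?F w)"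
  proof (rule Residue_theorem)
    show "open S"
      unfolding S_def by (intro open_Collect_conj open_halfspace_Re_gt open_halfspace_Re_lt)
    have "convex ({w. Re w > 0} \<inter> {w. Re w < real (Suc N) / sqrt 2})"
      by (intro convex_Int convex_halfspace_Re_gt convex_halfspace_Re_lt)
    moreover have "S = {w. Re w > 0} \<inter> {w. Re w < real (Suc N) / sqrt 2}" by (auto simp: S_def)
    ultimately show "connected S" by (simp add: convex_connected)
    show "?F holomorphic_on S - p ` {1..N}"
    proof (rule holomorphic_rotated_integrand)
      fix w n assume w: "w \<in> S - p ` {1..N}" and n: "n > (0::nat)"
      show "w \<noteq> of_nat n * cis (pi/4)"
      proof
        assume "w = of_nat n * cis (pi/4)"
        then have wp: "w = p n" by (simp add: p_def)
        then have "real n / sqrt 2 < real (Suc N) / sqrt 2" using w Re_p[of n] by (auto simp: S_def)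
        then have "n < Suc N" by (simp add: divide_less_cancel)
        then show False using w wp n by auto
      qed
    qed (auto simp: S_def)
    show "path_image ?R \<subseteq> S - p ` {1..N}"
    proof -
      have "path_image ?R \<subseteq> cbox (Complex v0 (-U)) (Complex v1 U)"
        using v U by (intro path_image_rectpath_subset_cbox) auto
      moreover have "path_image ?R \<inter> box (Complex v0 (-U)) (Complex v1 U) = {}"
        using v U by (intro path_image_rectpath_inter_box) auto
      ultimately show ?thesis using Scbox box by blast
    qed
    show "\<forall>z. z \<notin> S \<longrightarrow> winding_number ?R z = 0"
      using Scbox v U by (auto intro!: winding_number_rectpath_outside)
  qed auto
  also have "(\<Sum>w\<in>p ` {1..N}. winding_number ?R w * residue ?F w) = (\<Sum>n\<in>{1..N}. winding_number ?R (p n) * residue ?F (p n))"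
    using inj by (subst sum.reindex) (auto intro: inj_on_subset)
  also have "\<dots> = (\<Sum>n\<in>{1..N}. cis (pi/4) * (1 / of_nat n powr s) / (2 * of_real pi * \<i>))"
    using box by (intro sum.cong refl) (simp add: winding_number_rectpath residue_rotated_integrand p_def)
  also have "2 * pi * \<i> * \<dots> = cis (pi/4) * (\<Sum>n\<in>{1..N}. 1 / of_nat n powr s)"
    by (simp add: sum_distrib_left sum_divide_distrib[symmetric])
  finally show ?thesis .
qed

text \<open>Limit of the rectangle for growing height: the right edge runs upwards, the left edge
  downwards, and the horizontal edges vanish by the Gaussian decay.\<close>

lemma rotated_line_integral_diff:
  assumes s: "0 \<le> Re s" and v: "0 < v0" "v0 < 1 / sqrt 2" "real N / sqrt 2 < v1" "v1 < real (Suc N) / sqrt 2" "v0 < v1"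
  shows "\<i> * (rotated_line_integral s v1 - rotated_line_integral s v0) = cis (pi/4) * (\<Sum>n\<in>{1..N}. 1 / of_nat n powr s)"
proof -
  let ?F = "rotated_integrand s"
  let ?L = "\<lambda>v U. integral {-U..U} (\<lambda>u. ?F (Complex v u))"
  let ?h = "\<lambda>U. contour_integral (linepath (Complex v0 U) (Complex v1 U)) ?F"
  have v0n: "v0 \<noteq> real n / sqrt 2" for n
  proof
    assume "v0 = real n / sqrt 2"
    then have "0 < n" "n < 1" using v by (auto simp: divide_less_cancel zero_less_divide_iff)
    then show False by simp
  qed
  have v1n: "v1 \<noteq> real n / sqrt 2" for n
  proof
    assume "v1 = real n / sqrt 2"
    then have "N < n" "n < Suc N" using v by (auto simp: divide_less_cancel)
    then show False by simp
  qed
  have lim: "((?L v) \<longlongrightarrow> rotated_line_integral s v) at_top" if "0 < v" "\<And>n. v \<noteq> real n / sqrt 2" for v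
    unfolding rotated_line_integral_def
    using s that by (intro tendsto_integral_symmetric_interval integrable_rotated_line)
  define K where "K = v0 powr (- Re s) * exp (\<bar>Im s\<bar> * pi + pi * v1^2)"
  have side: "(?h \<longlongrightarrow> 0) at_top \<and> ((\<lambda>U. ?h (-U)) \<longlongrightarrow> 0) at_top"
  proof -
    have bound: "norm (?h U') \<le> K * exp (- pi * U^2) * (v1 - v0)" if "U' = U \<or> U' = -U" "real N + 1 + v1 + 1 \<le> U" for U U'
    proof -
      have seg: "\<exists>v. w = Complex v U' \<and> v0 \<le> v \<and> v \<le> v1" if "w \<in> closed_segment (Complex v0 U') (Complex v1 U')" for w
        using that v by (subst (asm) closed_segment_same_Im) (auto simp: closed_segment_eq_real_ivl complex_eq_iff)
      have "?F holomorphic_on closed_segment (Complex v0 U') (Complex v1 U')"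
      proof (rule holomorphic_rotated_integrand)
        fix w assume "w \<in> closed_segment (Complex v0 U') (Complex v1 U')"
        then obtain v' where w: "w = Complex v' U'" "v0 \<le> v'" "v' \<le> v1" using seg by blast
        show "Re w > 0" using w v by simp
        \<comment> \<open>Poles lie on the diagonal, which these horizontal segments do not
          meet.\<close>
        have "v' \<noteq> U'" using w(2,3) that v(1) by linarith
        then show "w \<noteq> of_nat n * cis (pi/4)" for n
          unfolding w using Re_Im_pole[of n] by (metis complex.sel)
      qed
      then have "?F contour_integrable_on linepath (Complex v0 U') (Complex v1 U')"
        by (intro contour_integrable_continuous_linepath holomorphic_on_imp_continuous_on)
      then have "norm (?h U') \<le> (K * exp (- pi * U^2)) * norm (Complex v1 U' - Complex v0 U')"
      proof (rule contour_integral_bound_linepath)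
        fix w assume "w \<in> closed_segment (Complex v0 U') (Complex v1 U')"
        then obtain v' where "w = Complex v' U'" "v0 \<le> v'" "v' \<le> v1" using seg by blast
        moreover have "v1 + 1 \<le> \<bar>U'\<bar>" "U'^2 = U^2" using that v by auto
        ultimately show "norm (?F w) \<le> K * exp (- pi * U^2)"
          using norm_rotated_integrand_le[of s v0 v' v1 U'] s v unfolding K_def by simp
      qed (simp add: K_def)
      also have "norm (Complex v1 U' - Complex v0 U') = v1 - v0"
        using v by (simp add: cmod_eq_Re)
      finally show ?thesis .
    qed
    have z: "((\<lambda>U. K * exp (- pi * U^2) * (v1 - v0)) \<longlongrightarrow> 0) at_top" by real_asymp
    have "(?h \<longlongrightarrow> 0) at_top"
      by (rule Lim_null_comparison[OF _ z]) (use bound in \<open>auto intro!: eventually_mono[OF eventually_ge_at_top[of "real N + 1 + v1 + 1"]]\<close>)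
    moreover have "((\<lambda>U. ?h (-U)) \<longlongrightarrow> 0) at_top"
      by (rule Lim_null_comparison[OF _ z]) (use bound in \<open>auto intro!: eventually_mono[OF eventually_ge_at_top[of "real N + 1 + v1 + 1"]]\<close>)
    ultimately show ?thesis by blast
  qed
  have "((\<lambda>U. \<i> * (?L v1 U - ?L v0 U) + ?h (-U) - ?h U) \<longlongrightarrow>
      \<i> * (rotated_line_integral s v1 - rotated_line_integral s v0) + 0 - 0) at_top"
    using side lim v v0n v1n by (intro tendsto_intros) auto
  moreover have "\<forall>\<^sub>F U in at_top. \<i> * (?L v1 U - ?L v0 U) + ?h (-U) - ?h U = cis (pi/4) * (\<Sum>n\<in>{1..N}. 1 / of_nat n powr s)"
    using eventually_ge_at_top[of "real N + 1 + v1 + 1"]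
  proof eventually_elim
    case (elim U)
    let ?R = "rectpath (Complex v0 (-U)) (Complex v1 U)"
    have U: "real N + 1 \<le> U" "0 < U" using elim v by auto
    have avoid: "w \<noteq> of_nat n * cis (pi/4)" if "w \<in> path_image ?R" for w n
    proof
      assume w: "w = of_nat n * cis (pi/4)"
      have eq: "Re w = real n / sqrt 2" "Im w = real n / sqrt 2" unfolding w by (rule Re_Im_pole)+
      have "Re w \<in> {v0, v1} \<or> Im w \<in> {-U, U} \<and> Re w \<in> {v0..v1}"
        using that v U by (subst (asm) path_image_rectpath) auto
      moreover have "Re w \<notin> {v0, v1}" using v0n[of n] v1n[of n] eq by auto
      ultimately have "Im w \<in> {-U, U}" "Re w \<in> {v0..v1}" by auto
      then show False using eq elim v(1) by auto
    qed
    have pos: "Re w > 0" if "w \<in> path_image ?R" for w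
      using that v U by (auto simp: path_image_rectpath)
    have holo: "?F holomorphic_on path_image ?R" using avoid pos by (intro holomorphic_rotated_integrand) auto
    have ci: "?F contour_integrable_on linepath a b" if "closed_segment a b \<subseteq> path_image ?R" for a b
      using holomorphic_on_imp_continuous_on[OF holo] that
      by (intro contour_integrable_continuous_linepath) (rule continuous_on_subset)
    have segs: "closed_segment (Complex v0 (-U)) (Complex v1 (-U)) \<subseteq> path_image ?R"
      "closed_segment (Complex v1 (-U)) (Complex v1 U) \<subseteq> path_image ?R"
      "closed_segment (Complex v1 U) (Complex v0 U) \<subseteq> path_image ?R"
      "closed_segment (Complex v0 U) (Complex v0 (-U)) \<subseteq> path_image ?R"
      by (auto simp: rectpath_def Let_def path_image_join)
    have "contour_integral ?R ?F = ?h (-U) + (contour_integral (linepath (Complex v1 (-U)) (Complex v1 U)) ?F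
       + (contour_integral (linepath (Complex v1 U) (Complex v0 U)) ?F
       + contour_integral (linepath (Complex v0 U) (Complex v0 (-U))) ?F))"
      unfolding rectpath_def Let_def using ci[OF segs(1)] ci[OF segs(2)] ci[OF segs(3)] ci[OF segs(4)]
      by (simp add: contour_integrable_joinI)
    also have "contour_integral (linepath (Complex v1 U) (Complex v0 U)) ?F = - ?h U"
      using contour_integral_reverse_linepath[of "Complex v0 U" "Complex v1 U" ?F] ci[OF segs(3)]
        holomorphic_on_imp_continuous_on[OF holo] segs(3)
      by (metis closed_segment_commute continuous_on_subset minus_minus)
    also have "contour_integral (linepath (Complex v0 U) (Complex v0 (-U))) ?F
        = - contour_integral (linepath (Complex v0 (-U)) (Complex v0 U)) ?F"
      using contour_integral_reverse_linepath[of "Complex v0 (-U)" "Complex v0 U" ?F]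
        holomorphic_on_imp_continuous_on[OF holo] segs(4)
      by (metis closed_segment_commute continuous_on_subset minus_minus)
    also have "contour_integral (linepath (Complex v0 (-U)) (Complex v0 U)) ?F = \<i> * ?L v0 U"
      using U by (intro contour_integral_linepath_same_Re) auto
    also have "contour_integral (linepath (Complex v1 (-U)) (Complex v1 U)) ?F = \<i> * ?L v1 U"
      using U by (intro contour_integral_linepath_same_Re) auto
    finally show ?case
      using contour_integral_rectpath_rotated[OF v U(1), of s] by (simp add: algebra_simps)
  qed
  ultimately have "((\<lambda>U. cis (pi/4) * (\<Sum>n\<in>{1..N}. 1 / of_nat n powr s)) \<longlongrightarrow>
      \<i> * (rotated_line_integral s v1 - rotated_line_integral s v0) + 0 - 0) (at_top :: real filter)"
    by (rule Lim_transform_eventually)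
  then show ?thesis by (simp add: tendsto_const_iff)
qed

lemma riemann_aux_line_eq:
  "riemann_aux_line c u = cis (- (pi/4)) * Complex (c / sqrt 2) (c / sqrt 2 + u)"
proof -
  have "cis (- (pi/4)) * Complex (c / sqrt 2) (c / sqrt 2 + u) = of_real c + of_real u * cis (pi/4)"
    by (rule complex_eqI) (simp_all add: Re_Im_rotated cos_45 sin_45 field_simps)
  then show ?thesis unfolding riemann_aux_line_def cis_conv_exp by (simp add: mult_ac)
qed

text \<open>The sign comes from the downward direction of the line and \<open>cis (pi/4)\<close>
  from its parametrization; the offset \<open>c / sqrt 2\<close> in the imaginary part disappears by
  translation invariance.\<close>

lemma riemann_aux_eq_rotated:
  "riemann_aux c s = - (cis (pi/4) * rotated_line_integral s (c / sqrt 2))"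
proof -
  have e: "exp (of_real pi * \<i> / 4) = cis (pi/4)" by (simp add: cis_conv_exp mult_ac)
  have "riemann_aux c s = - (LBINT u. rotated_integrand s (Complex (c / sqrt 2) (c / sqrt 2 + u)) * cis (pi/4))"
    unfolding riemann_aux_def interval_lebesgue_integral_def e riemann_aux_line_eq rotated_integrand_def
    by (simp add: einterval_def set_lebesgue_integral_def)
  also have "\<dots> = - (cis (pi/4) * (LBINT u. rotated_integrand s (Complex (c / sqrt 2) (c / sqrt 2 + u))))"
    by (simp add: mult.commute)
  also have "(LBINT u. rotated_integrand s (Complex (c / sqrt 2) (c / sqrt 2 + u))) = rotated_line_integral s (c / sqrt 2)"
    unfolding rotated_line_integral_def
    using lborel_integral_real_affine[of 1 "\<lambda>u. rotated_integrand s (Complex (c / sqrt 2) u)" "c / sqrt 2"] by simp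
  finally show ?thesis .
qed

text \<open>The remainder is the defining formula with crossing point \<open>N + 1/2\<close>,
  outside the interval where its value is Riemann's function.\<close>

lemma riemann_aux_minus_sum:
  assumes "0 \<le> Re s" "0 < c" "c < 1" "1 \<le> N"
  shows "riemann_aux c s - (\<Sum>n\<in>{1..N}. 1 / of_nat n powr s) = riemann_aux (real N + 1/2) s"
proof -
  have "c / sqrt 2 < 1 / sqrt 2" "real N / sqrt 2 < (real N + 1/2) / sqrt 2"
    "(real N + 1/2) / sqrt 2 < real (Suc N) / sqrt 2" "c / sqrt 2 < (real N + 1/2) / sqrt 2"
    using assms by (auto intro!: divide_strict_right_mono)
  then have "\<i> * (rotated_line_integral s ((real N + 1/2) / sqrt 2) - rotated_line_integral s (c / sqrt 2))
      = cis (pi/4) * (\<Sum>n\<in>{1..N}. 1 / of_nat n powr s)" (is "\<i> * ?D = cis _ * ?S")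
    using assms by (intro rotated_line_integral_diff) auto
  then have "cis (pi/4) * (\<i> * ?D) = cis (pi/4) * (cis (pi/4) * ?S)" by simp
  \<comment> \<open>Two rotations by \<open>pi/4\<close> make \<open>\<i>\<close>, which cancels the
    \<open>\<i>\<close> of the upward direction.\<close>
  also have "\<dots> = \<i> * ?S" by (simp add: cis_mult flip: mult.assoc)
  finally have "cis (pi/4) * ?D = ?S" by (simp add: mult.left_commute)
  then show ?thesis unfolding riemann_aux_eq_rotated by (simp add: algebra_simps)
qed

section \<open>The remainder\<close>

text \<open>Half-integrality of \<open>q\<close> turns the sine of the real part into a cosine of
  \<open>pi * q * y\<close>. Lowering the exponent from \<open>Re s\<close> to
  \<open>\<sigma>\<close> is possible because the modulus \<open>m\<close> is at least 1 on the
  whole line.\<close>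

lemma (in saddle) norm_riemann_aux_integrand_le_scaled:
  assumes N: "q = real N + 1/2" and s: "\<sigma> \<le> Re s" "Im s = 2 * pi * a^2"
  shows "a powr \<sigma> * cmod (riemann_aux_integrand s (riemann_aux_line q u)) \<le> scaled_integrand (u / (sqrt 2 * q))"
proof -
  define y where "y = u / (sqrt 2 * q)"
  define x where "x = riemann_aux_line q u"
  have xc: "x = of_real q * Complex (1 + y) y"
  proof -
    have "exp (of_real pi * \<i> / 4) = Complex (1 / sqrt 2) (1 / sqrt 2)"
      by (rule complex_eqI) (simp_all add: Re_exp Im_exp cos_45 sin_45 divide_simps)
    then show ?thesis unfolding x_def riemann_aux_line_def y_def using pos
      by (auto intro!: complex_eqI simp: field_simps)
  qed
  have Re: "Re x = q + q * y" and Im: "Im x = q * y" unfolding xc by (simp_all add: algebra_simps)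
  define m where "m = q * sqrt (1 + 2*y + 2*y^2)"
  have norm_x: "cmod x = m"
  proof -
    have "cmod x = q * cmod (Complex (1 + y) y)" unfolding xc using pos by (simp add: norm_mult)
    also have "cmod (Complex (1 + y) y) = sqrt (1 + 2*y + 2*y^2)"
      unfolding cmod_def by (simp add: power2_eq_square algebra_simps)
    finally show ?thesis unfolding m_def .
  qed
  have m1: "1 \<le> m"
  proof -
    have "1 + 2*y + 2*y^2 = 1/2 + 2 * (y + 1/2)^2" by algebra
    then have "1/2 \<le> 1 + 2*y + 2*y^2" by simp
    then have "(3/2)^2 * (1/2) \<le> q^2 * (1 + 2*y + 2*y^2)" using q by (intro mult_mono power_mono) auto
    then have "1 \<le> q^2 * (1 + 2*y + 2*y^2)" by (simp add: power2_eq_square)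
    then have "sqrt 1 \<le> sqrt (q^2 * (1 + 2*y + 2*y^2))" by (rule real_sqrt_le_mono)
    then show ?thesis unfolding m_def using pos by (simp add: real_sqrt_mult)
  qed
  have Arg: "Arg x = Arg (Complex (1 + y) y)" unfolding xc using pos by (simp add: Arg_times_of_real)
  have sin: "(sin (pi * Re x))^2 = (cos (pi * (q * y)))^2"
  proof -
    have e: "pi * Re x = (pi * (q * y) + pi/2) + real N * pi" unfolding Re N by (simp add: algebra_simps)
    have "sin (pi * (q * y) + pi/2 + real N * pi) = sin (pi * (q * y) + pi/2) * (-1)^N"
      by (simp add: sin_add[of _ "real N * pi"])
    then show ?thesis unfolding e by (simp add: power_mult_distrib sin_add flip: power_mult)
  qed
  have "cmod (riemann_aux_integrand s x) = m powr (- Re s) * exp (Im s * Arg x) * exp (- (2 * pi * Re x * Im x)) /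
    (2 * sqrt ((sin (pi * Re x))^2 + (sinh (pi * Im x))^2))"
    using norm_riemann_aux_integrand[of x s] m1 norm_x by force
  also have "\<dots> = m powr (- Re s) * (exp (Im s * Arg x) * exp (- (2 * pi * Re x * Im x))) /
    (2 * sqrt ((cos (pi * (q * y)))^2 + (sinh (pi * (q * y)))^2))"
    unfolding sin Im by simp
  also have "exp (Im s * Arg x) * exp (- (2 * pi * Re x * Im x))
      = exp (2 * pi * (a^2 * Arg (Complex (1 + y) y) - q^2 * (y + y^2)))"
    unfolding Arg s Re Im exp_add[symmetric] by (rule arg_cong[of _ _ exp]) (simp add: power2_eq_square algebra_simps)
  finally have eq: "cmod (riemann_aux_integrand s x) = m powr (- Re s) *
      exp (2 * pi * (a^2 * Arg (Complex (1 + y) y) - q^2 * (y + y^2))) /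
      (2 * sqrt ((cos (pi * (q * y)))^2 + (sinh (pi * (q * y)))^2))" .
  define Z where "Z = exp (2 * pi * (a^2 * Arg (Complex (1 + y) y) - q^2 * (y + y^2))) /
      (2 * sqrt ((cos (pi * (q * y)))^2 + (sinh (pi * (q * y)))^2))"
  have "a powr \<sigma> * cmod (riemann_aux_integrand s x) = (a powr \<sigma> * m powr (- Re s)) * Z"
    by (simp only: eq Z_def mult.assoc times_divide_eq_right)
  also have "\<dots> \<le> (a / m) powr \<sigma> * Z"
  proof (rule mult_right_mono)
    have "a powr \<sigma> * m powr (- Re s) \<le> a powr \<sigma> * m powr (- \<sigma>)"
      using s m1 by (intro mult_left_mono powr_mono) auto
    also have "\<dots> = (a / m) powr \<sigma>" using pos m1 by (simp add: powr_divide powr_minus_divide)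
    finally show "a powr \<sigma> * m powr (- Re s) \<le> (a / m) powr \<sigma>" .
  qed (simp add: Z_def)
  also have "\<dots> = scaled_integrand y" by (simp only: scaled_integrand_def m_def Z_def times_divide_eq_right)
  finally show ?thesis unfolding y_def x_def .
qed

lemma (in saddle) norm_riemann_aux_le:
  assumes N: "q = real N + 1/2" and s: "\<sigma> \<le> Re s" "Im s = 2 * pi * a^2"
  shows "cmod (riemann_aux q s) \<le> a powr (- \<sigma>)"
proof -
  let ?f = "\<lambda>u. of_real (a powr \<sigma>) * riemann_aux_integrand s (riemann_aux_line q u)"
  have meas: "?f \<in> borel_measurable lborel"
  proof -
    have q: "q / sqrt 2 > 0" using pos by simp
    have qn: "q / sqrt 2 \<noteq> real n / sqrt 2" for n
    proof
      assume "q / sqrt 2 = real n / sqrt 2"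
      then have "real (2 * N + 1) = real (2 * n)" using N by simp
      then have "2 * N + 1 = 2 * n" by (simp only: of_nat_eq_iff)
      then show False by presburger
    qed
    have "continuous_on UNIV (\<lambda>u. rotated_integrand s (Complex (q / sqrt 2) (q / sqrt 2 + u)))"
      by (rule continuous_on_compose2[OF continuous_rotated_line[OF q qn, of UNIV s]])
         (auto intro!: continuous_intros)
    then have "continuous_on UNIV (\<lambda>u. of_real (a powr \<sigma>) * rotated_integrand s (Complex (q / sqrt 2) (q / sqrt 2 + u)))"
      by (rule continuous_on_mult[OF continuous_on_const])
    then have "continuous_on UNIV ?f"
      unfolding riemann_aux_line_eq rotated_integrand_def .
    then have "?f \<in> borel_measurable borel" by (rule borel_measurable_continuous_onI)
    then show ?thesis unfolding measurable_lborel2 .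
  qed
  have le: "norm (?f u) \<le> scaled_integrand (u / (sqrt 2 * q))" for u
  proof -
    have "norm (?f u) = a powr \<sigma> * cmod (riemann_aux_integrand s (riemann_aux_line q u))"
      unfolding norm_mult norm_of_real by simp
    then show ?thesis using norm_riemann_aux_integrand_le_scaled[OF assms, of u] by (simp only:)
  qed
  have "norm (integral\<^sup>L lborel ?f) \<le> 1"
    by (rule norm_integral_le(2)[of ?f, OF meas le])
  also have "integral\<^sup>L lborel ?f = of_real (a powr \<sigma>) * (\<integral>u. riemann_aux_integrand s (riemann_aux_line q u) \<partial>lborel)"
    by (rule integral_mult_right_zero)
  also have "norm \<dots> = a powr \<sigma> * cmod (riemann_aux q s)"
    unfolding riemann_aux_def interval_lebesgue_integral_def
    by (simp add: einterval_def set_lebesgue_integral_def norm_mult)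
  finally show ?thesis using pos by (simp add: powr_minus field_simps)
qed

text \<open>Keeping \<open>\<sigma>\<close> apart from \<open>Re s\<close> covers both halves of the
  theorem: \<open>\<sigma> = Re s\<close> in the strip and \<open>\<sigma> = 1\<close> to the right
  of it.\<close>

lemma norm_riemann_aux_minus_sum_le:
  fixes c \<sigma> t :: real
  assumes c: "0 < c" "c < 1" and t: "3 * pi \<le> t" "Im s = t" and \<sigma>: "0 \<le> \<sigma>" "\<sigma> \<le> 1" "\<sigma> \<le> Re s"
  shows "cmod (riemann_aux c s - (\<Sum>n | 1 \<le> n \<and> real n \<le> sqrt (t / (2 * pi)). 1 / of_nat n powr s))
     \<le> (t / (2 * pi)) powr (- \<sigma> / 2)"
proof -
  define a where "a = sqrt (t / (2 * pi))"
  have t0: "0 < t" using t pi_gt_zero by linarith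
  have a2: "a^2 = t / (2 * pi)" unfolding a_def using t0 by simp
  \<comment> \<open>The threshold is \<open>4/5 * q\<close> for \<open>N = 1\<close>, and
    \<open>a^2 \<ge> 3/2\<close> exceeds its square.\<close>
  have a: "6/5 \<le> a" unfolding a_def
  proof (rule real_le_rsqrt)
    have "pi * 72 \<le> t * 25" using t pi_gt_zero by linarith
    then show "(6/5)^2 \<le> t / (2 * pi)" by (simp add: field_simps power2_eq_square)
  qed
  define N where "N = nat \<lfloor>a\<rfloor>"
  define q where "q = real N + 1/2"
  have N: "real N \<le> a" "a < real N + 1" "1 \<le> N"
    unfolding N_def using a by (auto simp: le_nat_iff le_floor_iff)
  \<comment> \<open>For \<open>N \<ge> 2\<close> already \<open>N \<ge> 4/5 * (N + 1/2)\<close>; the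
    case \<open>N = 1\<close> uses the bound \<open>6/5\<close>.\<close>
  have q45: "4/5 * q \<le> a"
  proof (cases "N = 1")
    case True then show ?thesis using a by (simp add: q_def)
  next
    case False
    then have "2 \<le> N" using N by simp
    then show ?thesis using N(1) by (simp add: q_def)
  qed
  have "\<bar>a - q\<bar> \<le> 1/2"
    using N unfolding q_def by (intro abs_leI) linarith+
  then interpret saddle q a \<sigma>
    using N q45 \<sigma> by unfold_locales (auto simp: q_def)
  have iff: "real n \<le> a \<longleftrightarrow> n \<le> N" for n
  proof
    assume "real n \<le> a"
    then have "real n < real (N + 1)" using N(2) unfolding of_nat_add of_nat_1 by linarith
    then have "n < N + 1" by (rule of_nat_less_imp_less)
    then show "n \<le> N" by simp
  next
    assume "n \<le> N"
    then have "real n \<le> real N" by simp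
    then show "real n \<le> a" using N(1) by (rule order_trans)
  qed
  have set: "{n. 1 \<le> n \<and> real n \<le> sqrt (t / (2 * pi))} = {1..N}"
    unfolding a_def[symmetric] iff by auto
  have "0 \<le> Re s" using \<sigma> by linarith
  then have "riemann_aux c s - (\<Sum>n\<in>{1..N}. 1 / of_nat n powr s) = riemann_aux q s"
    unfolding q_def by (rule riemann_aux_minus_sum[OF _ c N(3)])
  moreover have "cmod (riemann_aux q s) \<le> a powr (- \<sigma>)"
  proof (rule norm_riemann_aux_le[OF q_def \<sigma>(3)])
    show "Im s = 2 * pi * a^2" unfolding a2 t(2) by simp
  qed
  moreover have "a powr (- \<sigma>) = (t / (2 * pi)) powr (- \<sigma> / 2)"
  proof -
    have "a = (t / (2 * pi)) powr (1/2)" unfolding a_def using t0 by (simp add: powr_half_sqrt)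
    then show ?thesis by (simp only: powr_powr) simp
  qed
  ultimately show ?thesis unfolding set by (simp only:)
qed

theorem theorem10:
  fixes c \<sigma> t :: real and s :: complex
  assumes "0 < c" and "c < 1"
    and "s = Complex \<sigma> t"
  shows "(0 \<le> \<sigma> \<and> \<sigma> \<le> 1 \<and> t \<ge> 3 * pi \<longrightarrow>
           cmod (riemann_aux c s - (\<Sum>n | 1 \<le> n \<and> real n \<le> sqrt (t / (2 * pi)). 1 / of_nat n powr s))
             \<le> (t / (2 * pi)) powr (- \<sigma> / 2)) \<and>
         (\<sigma> \<ge> 1 \<and> t \<ge> 16 * pi \<longrightarrow>
           cmod (riemann_aux c s - (\<Sum>n | 1 \<le> n \<and> real n \<le> sqrt (t / (2 * pi)). 1 / of_nat n powr s))
             \<le> (t / (2 * pi)) powr (- 1 / 2))"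
proof (intro conjI impI)
  assume "0 \<le> \<sigma> \<and> \<sigma> \<le> 1 \<and> t \<ge> 3 * pi"
  then show "cmod (riemann_aux c s - (\<Sum>n | 1 \<le> n \<and> real n \<le> sqrt (t / (2 * pi)). 1 / of_nat n powr s))
      \<le> (t / (2 * pi)) powr (- \<sigma> / 2)"
    using assms by (intro norm_riemann_aux_minus_sum_le) auto
next
  assume "\<sigma> \<ge> 1 \<and> t \<ge> 16 * pi"
  moreover from this have "3 * pi \<le> t" using pi_gt_zero by linarith
  \<comment> \<open>Matching the exponent \<open>- 1 / 2\<close> sets the weight exponent of the
    lemma to 1, while \<open>Re s\<close> stays \<open>\<sigma>\<close>.\<close>
  ultimately show "cmod (riemann_aux c s - (\<Sum>n | 1 \<le> n \<and> real n \<le> sqrt (t / (2 * pi)). 1 / of_nat n powr s))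
      \<le> (t / (2 * pi)) powr (- 1 / 2)"
    using assms by (intro norm_riemann_aux_minus_sum_le) auto
qed

end
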